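(* Let $L=\mathbb{Q}(\alpha)$ be a cubic number field, where $\alpha$ is a root of $f(x)=x^3-ax+b$ with $a,b\in\mathbb{Z}$ such that for every prime $p$ one has $v_p(a)<2$ or $v_p(b)<3$, and let $\Delta=4a^3-27b^2$. Then $\{1,\alpha,\alpha^2\}$ is an integral basis of $L$ (that is, $\mathcal{O}_L=\mathbb{Z}[\alpha]$) if and only if all three of the following hold: 1. (for $p=2$) exactly one of the following holds: (a) $b\equiv1\pmod 2$; (b) $a\equiv0\pmod 2$ and $b\equiv2\pmod 4$; (c) $a\equiv3\pmod 4$ and $b\equiv0\pmod 4$; (d) $a\equiv1\pmod 4$ and $b\equiv2\pmod 4$. 2. (for $p=3$) exactly one of the following holds: (a) $v_3(a)=0$; (b) $v_3(a)\ge1$ and $v_3(b)=1$; (c) $v_3(a)\ge1$, $a\not\equiv3\pmod 9$, $v_3(b)=0$ and $b^2\not\equiv a+1\pmod 9$; (d) $a\equiv3\pmod 9$, $v_3(b)=0$ and $b^2\not\equiv4\pmod 9$. 3. for every prime $p>3$ exactly one of the following holds: (a) $v_p(a)=0$ and $v_p(b)\ge1$; (b) $v_p(a)\ge1$ and $v_p(b)\le1$; (c) $v_p(a)=v_p(b)=0$ and $v_p(\Delta)\le1$.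
   Context: $v_p$ is the $p$-adic valuation, with $v_p(0)=\infty$. $\mathcal{O}_L$ is the ring of integers of $L$; an integral basis of $L$ is a $\mathbb{Z}$-basis of $\mathcal{O}_L$. *)

theory Defs
  imports
    Complex_Main
    "HOL-Computational_Algebra.Computational_Algebra"
    "HOL-Number_Theory.Cong"
    "HOL-Library.Extended_Nat"
begin

text \<open>
  Number fields are subfields of an arbitrary ambient field of characteristic 0. The ambient field
  is a type, the number field a set.
\<close>

definition is_subfield :: "'a :: field set \<Rightarrow> bool" where
  "is_subfield K \<longleftrightarrow> 0 \<in> K \<and> 1 \<in> K \<and>
     (\<forall>x\<in>K. \<forall>y\<in>K. x + y \<in> K \<and> x * y \<in> K) \<and> (\<forall>x\<in>K. - x \<in> K \<and> inverse x \<in> K)"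

text \<open>In characteristic 0 every subfield contains the rationals, so this is $\mathbb{Q}(\alpha)$.\<close>

definition rat_adjoin :: "'a :: field_char_0 \<Rightarrow> 'a set" where
  "rat_adjoin \<alpha> = \<Inter>{K. is_subfield K \<and> \<alpha> \<in> K}"

definition int_adjoin :: "'a :: field_char_0 \<Rightarrow> 'a set" where
  "int_adjoin \<alpha> = range (\<lambda>p :: int poly. poly (map_poly of_int p) \<alpha>)"

global_interpretation rat_lin: vector_space "\<lambda>(q::rat) (x::'a::field_char_0). of_rat q * x"
  by unfold_locales (simp_all add: algebra_simps of_rat_add of_rat_mult)

global_interpretation int_lin: module "\<lambda>(n::int) (x::'a::field_char_0). of_int n * x"
  by unfold_locales (simp_all add: algebra_simps)

text \<open>
  \<open>rat_lin.dim\<close> is 0 for infinite-dimensional spaces, so dimension 3 includes finiteness of the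
  extension.
\<close>

definition is_cubic_number_field :: "'a :: field_char_0 set \<Rightarrow> bool" where
  "is_cubic_number_field L \<longleftrightarrow> is_subfield L \<and> rat_lin.dim L = 3"

definition ring_of_integers :: "'a :: field_char_0 set \<Rightarrow> 'a set" where
  "ring_of_integers L = {x \<in> L. algebraic_int x}"

definition is_integral_basis :: "'a :: field_char_0 set \<Rightarrow> 'a set \<Rightarrow> bool" where
  "is_integral_basis L B \<longleftrightarrow> int_lin.independent B \<and> int_lin.span B = ring_of_integers L"

text \<open>The case split is needed because \<open>multiplicity p 0 = 0\<close> in the library.\<close>

definition padic_val :: "nat \<Rightarrow> int \<Rightarrow> enat" where
  "padic_val p n = (if n = 0 then \<infinity> else enat (multiplicity (int p) n))"

definition exactly_one :: "bool list \<Rightarrow> bool" where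
  "exactly_one Ps \<longleftrightarrow> (\<exists>!i. i < length Ps \<and> Ps ! i)"

end

theory Submission
  imports Defs "Jordan_Normal_Form.Char_Poly"
begin

text \<open>
  Write \<open>f = x^3 - a x + b\<close>. The order \<open>\<int>[\<alpha>]\<close> fails to be maximal exactly if some prime \<open>p\<close> and
  some integer \<open>r\<close> satisfy \<open>p dvd f'(r)\<close> and \<open>p^2 dvd f(r)\<close>. Given such \<open>p\<close> and \<open>r\<close>, the element
  \<open>(\<alpha>^2 + r \<alpha> + r^2 - a) / p\<close> is integral, its characteristic polynomial being that of the reciprocal of
  \<open>\<alpha> - r\<close> rescaled by \<open>-f(r) / p\<close>. Conversely, the \<open>h\<close> in \<open>\<int>[\<alpha>]\<close> with \<open>h / p\<close> integral form an ideal whose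
  elements are nilpotent modulo \<open>p\<close>; an element of least degree in it is linear or quadratic, and either
  way it produces a double root \<open>r\<close> of \<open>f\<close> modulo \<open>p\<close> for which \<open>(\<alpha>^2 + r \<alpha> + r^2 - a) / p\<close> is integral; this
  forces \<open>p^2 dvd f(r)\<close>. The three local conditions say that no such \<open>r\<close> exists: the only candidates are
  \<open>r = 0, 1\<close> for \<open>p = 2\<close>, \<open>r = -b\<close> for \<open>p = 3\<close>, and for \<open>p > 3\<close> either \<open>r = 0\<close> or \<open>r = 3 b / (2 a)\<close>, where
  \<open>f\<close> and \<open>f'\<close> are unit multiples of \<open>b \<Delta>\<close> and \<open>\<Delta>\<close>.
\<close>

subsection \<open>Sums and products of algebraic integers\<close>

text \<open>
  The determinant trick: \<open>x\<close> is an eigenvalue of the integer matrix that describes multiplication by \<open>x\<close>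
  on the generators \<open>S\<close>.
\<close>

lemma algebraic_int_if_stable_span:
  fixes x :: "'a :: field_char_0"
  assumes fin: "finite S" and s0: "s0 \<in> S" "s0 \<noteq> 0"
    and stable: "\<And>s. s \<in> S \<Longrightarrow> x * s \<in> int_lin.span S"
  shows "algebraic_int x"
proof -
  define n where "n = card S"
  obtain g where g: "bij_betw g {..<n} S"
    using ex_bij_betw_nat_finite[OF fin] by (auto simp: n_def lessThan_atLeast0)
  have "\<exists>u. x * s = (\<Sum>t\<in>S. of_int (u t) * t)" if "s \<in> S" for s
    using stable[OF that] by (auto simp: int_lin.span_finite[OF fin])
  then obtain c :: "'a \<Rightarrow> 'a \<Rightarrow> int" where c: "\<And>s. s \<in> S \<Longrightarrow> x * s = (\<Sum>t\<in>S. of_int (c s t) * t)"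
    by metis
  define A where "A = mat n n (\<lambda>(i,j). c (g i) (g j))"
  define B :: "'a mat" where "B = map_mat of_int A"
  have A: "A \<in> carrier_mat n n" and B: "B \<in> carrier_mat n n"
    by (auto simp: A_def B_def)
  obtain i0 where i0: "i0 < n" "g i0 = s0"
    using g s0(1) by (auto simp: bij_betw_def)
  have ev: "B *\<^sub>v vec n g = x \<cdot>\<^sub>v vec n g"
  proof (rule eq_vecI)
    fix i assume i: "i < dim_vec (x \<cdot>\<^sub>v vec n g)"
    then have gi: "g i \<in> S" using g by (auto simp: bij_betw_def)
    have "(B *\<^sub>v vec n g) $ i = (\<Sum>j<n. of_int (c (g i) (g j)) * g j)"
      using i by (simp add: B_def A_def scalar_prod_def lessThan_atLeast0)
    also have "\<dots> = (\<Sum>t\<in>S. of_int (c (g i) t) * t)"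
      by (rule sum.reindex_bij_betw[OF g])
    finally show "(B *\<^sub>v vec n g) $ i = (x \<cdot>\<^sub>v vec n g) $ i"
      using c[OF gi] i by simp
  qed (simp add: B_def A_def)
  have "vec n g $ i0 \<noteq> 0\<^sub>v n $ i0" using i0 s0 by simp
  then have "eigenvector B (vec n g) x"
    unfolding eigenvector_def using ev B by auto
  then have "eigenvalue B x" by (auto simp: eigenvalue_def)
  then have "poly (char_poly B) x = 0"
    using eigenvalue_root_char_poly[OF B] by simp
  moreover have "char_poly B = map_poly of_int (char_poly A)"
    unfolding B_def by (rule of_int_hom.char_poly_hom[OF A])
  moreover have "lead_coeff (char_poly A) = 1"
    using degree_monic_char_poly[OF A] by simp
  ultimately show ?thesis
    by (auto simp: algebraic_int_altdef_ipoly)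
qed

lemma algebraic_int_power_eq:
  fixes x :: "'a :: field_char_0"
  assumes "algebraic_int x"
  obtains n :: nat and c :: "nat \<Rightarrow> int"
  where "n > 0" "x ^ n = (\<Sum>i<n. of_int (c i) * x ^ i)"
proof -
  obtain p :: "int poly" where p: "poly (map_poly of_int p) x = 0" "lead_coeff p = 1"
    using assms by (auto simp: algebraic_int_altdef_ipoly)
  have "(\<Sum>i\<le>degree p. of_int (coeff p i) * x ^ i) = 0"
    using p(1) by (simp add: poly_altdef degree_map_poly coeff_map_poly)
  then have eq: "(\<Sum>i<degree p. of_int (coeff p i) * x ^ i) + x ^ degree p = 0"
    using p(2) by (simp flip: lessThan_Suc_atMost)
  \<comment> \<open>In degree 0 the relation would read \<open>1 = 0\<close>, because
    \<open>p\<close> is monic.\<close>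
  have "degree p > 0"
    using eq by (cases "degree p") auto
  moreover have "x ^ degree p = (\<Sum>i<degree p. of_int (- coeff p i) * x ^ i)"
    using eq by (simp add: sum_negf eq_neg_iff_add_eq_0 add.commute)
  ultimately show thesis by (rule that)
qed

lemma mult_mem_int_span:
  fixes x :: "'a :: field_char_0"
  assumes "\<And>s. s \<in> S \<Longrightarrow> x * s \<in> int_lin.span T" and "t \<in> int_lin.span S"
  shows "x * t \<in> int_lin.span T"
  using assms(2)
proof (induction rule: int_lin.span_induct_alt)
  case base
  show ?case by (simp add: int_lin.span_zero)
next
  case (step c u v)
  have "x * (of_int c * u + v) = of_int c * (x * u) + x * v"
    by (simp add: algebra_simps)
  then show ?case
    using int_lin.span_add[OF int_lin.span_scale[OF assms(1)[OF step(1)]] step(2)] by simp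
qed

text \<open>Multiplication by \<open>x\<close> raises the exponent of \<open>x\<close> by one; only
  the top exponent leaves the range, and there \<open>eq\<close> lowers it again. The exponents
  \<open>J\<close> of \<open>y\<close> are left arbitrary, so that the lemma can serve either
  variable.\<close>

lemma algebraic_int_stable_powers:
  fixes x y :: "'a :: field_char_0"
  assumes eq: "x ^ m = (\<Sum>i<m. of_int (c i) * x ^ i)"
    and s: "s \<in> (\<lambda>(i, j). x ^ i * y ^ j) ` ({..<m} \<times> J)"
  shows "x * s \<in> int_lin.span ((\<lambda>(i, j). x ^ i * y ^ j) ` ({..<m} \<times> J))" (is "_ \<in> int_lin.span ?S")
proof -
  obtain i j where ij: "i < m" "j \<in> J" "s = x ^ i * y ^ j" using s by auto
  show ?thesis
  proof (cases "Suc i < m")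
    case True
    then have "x ^ Suc i * y ^ j \<in> ?S" using ij by force
    then show ?thesis using ij by (simp add: int_lin.span_base mult.assoc)
  next
    case False
    then have "m = Suc i" using ij by simp
    then have "x * s = x ^ m * y ^ j" using ij by (simp add: mult_ac)
    also have "\<dots> = (\<Sum>i<m. of_int (c i) * (x ^ i * y ^ j))"
      unfolding eq by (simp add: sum_distrib_right mult.assoc)
    also have "\<dots> \<in> int_lin.span ?S"
      using ij by (intro int_lin.span_sum int_lin.span_scale int_lin.span_base) force
    finally show ?thesis .
  qed
qed

text \<open>The monomials \<open>x ^ i * y ^ j\<close> with exponents below the degrees of two monic
  equations span a finitely generated module that \<open>x\<close> and \<open>y\<close> both map
  into itself. So do their sum and product, and the determinant trick applies.\<close>

lemma algebraic_int_add_mult: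
  fixes x y :: "'a :: field_char_0"
  assumes "algebraic_int x" "algebraic_int y"
  shows "algebraic_int (x + y) \<and> algebraic_int (x * y)"
proof -
  obtain m c where m: "m > 0" "x ^ m = (\<Sum>i<m. of_int (c i) * x ^ i)"
    using algebraic_int_power_eq[OF assms(1)] .
  obtain n d where n: "n > 0" "y ^ n = (\<Sum>i<n. of_int (d i) * y ^ i)"
    using algebraic_int_power_eq[OF assms(2)] .
  define S where "S = (\<lambda>(i, j). x ^ i * y ^ j) ` ({..<m} \<times> {..<n})"
  \<comment> \<open>With the roles of \<open>x\<close> and \<open>y\<close> exchanged, the same
    stability lemma covers multiplication by \<open>y\<close>.\<close>
  have S': "S = (\<lambda>(i, j). y ^ i * x ^ j) ` ({..<n} \<times> {..<m})"
    unfolding S_def by (force simp: mult.commute image_iff)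
  have x: "x * s \<in> int_lin.span S" if "s \<in> S" for s
    using algebraic_int_stable_powers[OF m(2)] that unfolding S_def by blast
  have y: "y * s \<in> int_lin.span S" if "s \<in> S" for s
    using algebraic_int_stable_powers[OF n(2)] that unfolding S' by blast
  have one: "finite S" "1 \<in> S" "(1::'a) \<noteq> 0"
    using m(1) n(1) by (force simp: S_def)+
  have "algebraic_int (x + y)"
    using x y by (intro algebraic_int_if_stable_span[OF one]) (simp add: distrib_right int_lin.span_add)
  moreover have "x * y * s \<in> int_lin.span S" if "s \<in> S" for s
    using mult_mem_int_span[OF x y[OF that]] by (simp add: mult.assoc)
  then have "algebraic_int (x * y)"
    by (intro algebraic_int_if_stable_span[OF one])
  ultimately show ?thesis by blast
qed

lemmas algebraic_int_add = algebraic_int_add_mult[THEN conjunct1]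
  and algebraic_int_mult = algebraic_int_add_mult[THEN conjunct2]

lemma algebraic_int_diff:
  fixes x y :: "'a :: field_char_0"
  assumes "algebraic_int x" "algebraic_int y"
  shows "algebraic_int (x - y)"
  using algebraic_int_add[OF assms(1) algebraic_int_minus[OF assms(2)]] by simp

lemma algebraic_int_of_int_divide:
  assumes "algebraic_int (of_int m / of_int n :: 'a :: field_char_0)" "n \<noteq> 0"
  shows "n dvd m"
proof -
  have "(of_int m / of_int n :: 'a) \<in> \<int>"
    using assms by (intro rational_algebraic_int_is_int) auto
  then obtain k where "of_int m / of_int n = (of_int k :: 'a)" by (auto elim: Ints_cases)
  then have "of_int m = (of_int (k * n) :: 'a)" using assms(2) by (simp add: field_simps)
  then have "m = k * n" by (simp only: of_int_eq_iff)
  then show ?thesis by simp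
qed

subsection \<open>The order and the field generated by a cubic integer\<close>

definition zcomb :: "'a :: field_char_0 \<Rightarrow> int \<Rightarrow> int \<Rightarrow> int \<Rightarrow> 'a" where
  "zcomb \<alpha> u v w = of_int u + of_int v * \<alpha> + of_int w * \<alpha> ^ 2"

definition qcomb :: "'a :: field_char_0 \<Rightarrow> rat \<Rightarrow> rat \<Rightarrow> rat \<Rightarrow> 'a" where
  "qcomb \<alpha> u v w = of_rat u + of_rat v * \<alpha> + of_rat w * \<alpha> ^ 2"

lemma zcomb_eq_qcomb: "zcomb \<alpha> u v w = qcomb \<alpha> (of_int u) (of_int v) (of_int w)"
  by (simp add: zcomb_def qcomb_def)

lemma zcomb_add: "zcomb \<alpha> u v w + zcomb \<alpha> u' v' w' = zcomb \<alpha> (u + u') (v + v') (w + w')"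
  by (simp add: zcomb_def algebra_simps)

lemma zcomb_diff: "zcomb \<alpha> u v w - zcomb \<alpha> u' v' w' = zcomb \<alpha> (u - u') (v - v') (w - w')"
  by (simp add: zcomb_def algebra_simps)

lemma zcomb_scale: "of_int k * zcomb \<alpha> u v w = zcomb \<alpha> (k * u) (k * v) (k * w)"
  by (simp only: zcomb_def of_int_mult distrib_left mult.assoc)

lemma of_int_eq_zcomb: "of_int k = zcomb \<alpha> k 0 0"
  by (simp add: zcomb_def)

locale cubic_root =
  fixes \<alpha> :: "'a :: field_char_0" and a b :: int
  assumes root: "\<alpha> ^ 3 - of_int a * \<alpha> + of_int b = 0"
begin

lemma algebraic_int_alpha: "algebraic_int \<alpha>"
proof -
  have "poly (map_poly of_int [:b, -a, 0, 1:]) \<alpha> = \<alpha> ^ 3 - of_int a * \<alpha> + of_int b"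
    by (simp add: map_poly_pCons algebra_simps power3_eq_cube)
  with root show ?thesis
    unfolding algebraic_int_altdef_ipoly by (intro exI[of _ "[:b, -a, 0, 1:]"]) auto
qed

lemma qcomb_mult:
  "qcomb \<alpha> u v w * qcomb \<alpha> u' v' w' =
     qcomb \<alpha> (u * u' - of_int b * (v * w' + w * v')) 
       (u * v' + v * u' + of_int a * (v * w' + w * v') - of_int b * w * w')
       (u * w' + v * v' + w * u' + of_int a * w * w')"
proof -
  \<comment> \<open>The formal product has degree 4 in \<open>\<alpha>\<close>. The last summand is
    the cubic times the quotient of that product by it, so this is a pure ring identity.\<close>
  have "qcomb \<alpha> u v w * qcomb \<alpha> u' v' w' =
     qcomb \<alpha> (u * u' - of_int b * (v * w' + w * v')) 
       (u * v' + v * u' + of_int a * (v * w' + w * v') - of_int b * w * w')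
       (u * w' + v * v' + w * u' + of_int a * w * w')
     + (of_rat (v * w' + w * v') + of_rat (w * w') * \<alpha>) * (\<alpha> ^ 3 - of_int a * \<alpha> + of_int b)"
    by (simp add: qcomb_def of_rat_add of_rat_mult of_rat_diff algebra_simps power2_eq_square power3_eq_cube)
  then show ?thesis by (simp add: root)
qed

lemma zcomb_mult:
  "zcomb \<alpha> u v w * zcomb \<alpha> u' v' w' =
     zcomb \<alpha> (u * u' - b * (v * w' + w * v')) 
       (u * v' + v * u' + a * (v * w' + w * v') - b * w * w')
       (u * w' + v * v' + w * u' + a * w * w')"
  unfolding zcomb_eq_qcomb qcomb_mult by simp

lemma poly_eq_zcomb: "\<exists>u v w. poly (map_poly of_int p) \<alpha> = zcomb \<alpha> u v w"
proof (induction p)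
  case 0
  show ?case by (intro exI[of _ 0]) (simp add: zcomb_def)
next
  case (pCons c p)
  then obtain u v w where *: "poly (map_poly of_int p) \<alpha> = zcomb \<alpha> u v w" by blast
  have "poly (map_poly of_int (pCons c p)) \<alpha> = zcomb \<alpha> c 0 0 + zcomb \<alpha> 0 1 0 * zcomb \<alpha> u v w"
    using pCons(1) by (simp add: map_poly_pCons * zcomb_def)
  then show ?case unfolding zcomb_mult zcomb_add by blast
qed

lemma int_adjoin_eq: "int_adjoin \<alpha> = {zcomb \<alpha> u v w | u v w. True}"
proof (intro equalityI subsetI)
  fix x assume "x \<in> {zcomb \<alpha> u v w | u v w. True}"
  then obtain u v w where "x = zcomb \<alpha> u v w" by blast
  then have "x = poly (map_poly of_int [:u, v, w:]) \<alpha>"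
    by (simp add: zcomb_def of_int_hom.map_poly_pCons_hom algebra_simps power2_eq_square)
  then show "x \<in> int_adjoin \<alpha>" by (auto simp: int_adjoin_def)
next
  fix x assume "x \<in> int_adjoin \<alpha>"
  then show "x \<in> {zcomb \<alpha> u v w | u v w. True}"
    unfolding int_adjoin_def using poly_eq_zcomb by blast
qed

lemma zcomb_in: "zcomb \<alpha> u v w \<in> int_adjoin \<alpha>"
  unfolding int_adjoin_eq by blast

lemma int_adjoinE:
  assumes "x \<in> int_adjoin \<alpha>" obtains u v w where "x = zcomb \<alpha> u v w"
  using assms unfolding int_adjoin_eq by blast

lemma int_adjoin_add:
  assumes "x \<in> int_adjoin \<alpha>" "y \<in> int_adjoin \<alpha>"
  shows "x + y \<in> int_adjoin \<alpha>"
  using assms(1) by (rule int_adjoinE, use assms(2) in \<open>rule int_adjoinE\<close>) (simp only: zcomb_add zcomb_in)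

lemma int_adjoin_diff:
  assumes "x \<in> int_adjoin \<alpha>" "y \<in> int_adjoin \<alpha>"
  shows "x - y \<in> int_adjoin \<alpha>"
  using assms(1) by (rule int_adjoinE, use assms(2) in \<open>rule int_adjoinE\<close>) (simp only: zcomb_diff zcomb_in)

lemma int_adjoin_mult:
  assumes "x \<in> int_adjoin \<alpha>" "y \<in> int_adjoin \<alpha>"
  shows "x * y \<in> int_adjoin \<alpha>"
  using assms(1) by (rule int_adjoinE, use assms(2) in \<open>rule int_adjoinE\<close>) (simp only: zcomb_mult zcomb_in)

lemma int_adjoin_of_int: "of_int k \<in> int_adjoin \<alpha>"
  by (simp add: of_int_eq_zcomb[of _ \<alpha>] zcomb_in)

lemma int_adjoin_sum: "(\<And>i. i \<in> I \<Longrightarrow> f i \<in> int_adjoin \<alpha>) \<Longrightarrow> sum f I \<in> int_adjoin \<alpha>"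
  using int_adjoin_of_int[of 0]
  by (induction I rule: infinite_finite_induct) (simp_all add: int_adjoin_add)

lemma int_adjoin_power: "x \<in> int_adjoin \<alpha> \<Longrightarrow> x ^ n \<in> int_adjoin \<alpha>"
  using int_adjoin_of_int[of 1] by (induction n) (simp_all add: int_adjoin_mult)

lemma algebraic_int_zcomb: "algebraic_int (zcomb \<alpha> u v w)"
  unfolding zcomb_def power2_eq_square
  by (intro algebraic_int_add algebraic_int_mult algebraic_int_alpha algebraic_int_of_int)

lemma algebraic_int_int_adjoin: "x \<in> int_adjoin \<alpha> \<Longrightarrow> algebraic_int x"
  by (metis int_adjoinE algebraic_int_zcomb)

lemma qcomb_add: "qcomb \<alpha> u v w + qcomb \<alpha> u' v' w' = qcomb \<alpha> (u + u') (v + v') (w + w')"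
  by (simp add: qcomb_def of_rat_add algebra_simps)

lemma qcomb_scale: "of_rat k * qcomb \<alpha> u v w = qcomb \<alpha> (k * u) (k * v) (k * w)"
  by (simp only: qcomb_def of_rat_mult distrib_left mult.assoc)

text \<open>
  The witnesses are the coefficients of the characteristic polynomial of multiplication by \<open>x\<close>
  in the basis of powers of \<open>\<alpha>\<close>.
\<close>

lemma qcomb_cubic:
  fixes u v w
  defines "x \<equiv> qcomb \<alpha> u v w"
  shows "\<exists>T S N :: rat. x * (x * x) + of_rat T * (x * x) + of_rat S * x = of_rat N"
proof -
  define A B where "A = rat_of_int a" and "B = rat_of_int b"
  have N: "of_rat N = qcomb \<alpha> N 0 0" for N by (simp add: qcomb_def)
  show ?thesis
    unfolding x_def qcomb_mult qcomb_scale qcomb_add A_def[symmetric] B_def[symmetric] N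
    apply (rule exI[of _ "-(3*u + 2*A*w)"])
    apply (rule exI[of _ "3*u^2 + 4*A*u*w - A*v^2 + 3*B*v*w + A^2*w^2"])
    apply (rule exI[of _ "u^3 + 2*A*u^2*w - A*u*v^2 + 3*B*u*v*w + A^2*u*w^2 - B*v^3 + A*B*v*w^2 + B^2*w^3"])
    by (intro arg_cong3[where f = "qcomb \<alpha>"]; simp add: algebra_simps power2_eq_square power3_eq_cube)
qed

end

section \<open>The field generated by \<open>\<alpha>\<close>, in rational coordinates\<close>

lemma is_subfield_of_rat:
  fixes K :: "'a :: field_char_0 set"
  assumes "is_subfield K"
  shows "of_rat q \<in> K"
proof -
  have K: "0 \<in> K" "1 \<in> K" "\<And>x y. x \<in> K \<Longrightarrow> y \<in> K \<Longrightarrow> x + y \<in> K \<and> x * y \<in> K"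
    "\<And>x. x \<in> K \<Longrightarrow> - x \<in> K \<and> inverse x \<in> K"
    using assms by (auto simp: is_subfield_def)
  have nat: "of_nat n \<in> K" for n
    by (induction n) (simp_all add: K)
  have int: "of_int n \<in> K" for n
    by (cases n rule: int_cases2) (simp_all add: nat K)
  obtain m n where "q = of_int m / of_int n"
    by (metis Fract_of_int_quotient Rat_cases)
  then have "of_rat q = (of_int m * inverse (of_int n) :: 'a)"
    by (simp add: of_rat_divide divide_inverse of_rat_mult of_rat_inverse)
  then show ?thesis
    using K int by simp
qed

context cubic_root
begin

lemma qcomb_of_rat: "qcomb \<alpha> u 0 0 = of_rat u"
  by (simp add: qcomb_def)

text \<open>The cubic relation writes \<open>N\<close> as \<open>x\<close> times a quadratic
  expression in \<open>x\<close>, so dividing by \<open>N\<close> inverts \<open>x\<close>. The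
  cubic of \<open>\<alpha>\<close> may be reducible here, so \<open>N\<close> can vanish for nonzero
  \<open>x\<close>; then \<open>x\<close> satisfies a relation of lower degree, first with constant
  \<open>- S\<close>, finally \<open>x = - T\<close>.\<close>

lemma qcomb_inverse: "\<exists>u' v' w'. inverse (qcomb \<alpha> u v w) = qcomb \<alpha> u' v' w'"
proof (cases "qcomb \<alpha> u v w = 0")
  case True
  then show ?thesis by (metis qcomb_of_rat of_rat_0 inverse_zero)
next
  case False
  define x where "x = qcomb \<alpha> u v w"
  have x0: "x \<noteq> 0" using False by (simp add: x_def)
  have inv: "\<exists>u' v' w'. inverse x = qcomb \<alpha> u' v' w'"
    if "x * y = of_rat N" "N \<noteq> 0" "y = qcomb \<alpha> r s t" for y N r s t
  proof -
    have "x * (of_rat (inverse N) * y) = 1"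
      using that(1,2) by (metis mult.left_commute of_rat_1 of_rat_mult left_inverse)
    then have "inverse x = of_rat (inverse N) * y"
      by (rule inverse_unique)
    then show ?thesis unfolding that(3) qcomb_scale by blast
  qed
  obtain T S N :: rat where cubic: "x * (x * x) + of_rat T * (x * x) + of_rat S * x = of_rat N"
    using qcomb_cubic[of u v w] unfolding x_def by blast
  have lin: "x + of_rat T = qcomb \<alpha> (u + T) v w"
    unfolding x_def qcomb_of_rat[symmetric, of T] qcomb_add by simp
  have x1: "x * (x * x + of_rat T * x + of_rat S) = of_rat N"
    using cubic by (simp only: distrib_left mult.commute mult.left_commute)
  show ?thesis
  proof (cases "N = 0")
    case False
    have "\<exists>r s t. x * x + of_rat T * x + of_rat S = qcomb \<alpha> r s t"
      unfolding qcomb_of_rat[symmetric, of S] x_def qcomb_mult qcomb_scale qcomb_add by blast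
    then show ?thesis using inv[OF x1 False] by (auto simp: x_def)
  next
    case N: True
    then have "x * x + of_rat T * x + of_rat S = 0"
      using x1 x0 by (metis mult_eq_0_iff of_rat_0)
    then have x2: "x * (x + of_rat T) = of_rat (- S)"
      by (simp only: distrib_left of_rat_minus eq_neg_iff_add_eq_0 mult.commute)
    show ?thesis
    proof (cases "S = 0")
      case False
      then show ?thesis using inv[OF x2 _ lin] by (simp add: x_def)
    next
      case True
      then have "x + of_rat T = 0" using x2 x0 by simp
      then have xT: "x = of_rat (- T)" by (simp add: eq_neg_iff_add_eq_0 of_rat_minus)
      then have "inverse x = qcomb \<alpha> (inverse (- T)) 0 0"
        by (simp only: of_rat_inverse qcomb_of_rat)
      then show ?thesis unfolding x_def by blast
    qed
  qed
qed

lemma rat_adjoin_eq: "rat_adjoin \<alpha> = {qcomb \<alpha> u v w | u v w. True}" (is "_ = ?K")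
proof
  have "x + y \<in> ?K \<and> x * y \<in> ?K" if xy: "x \<in> ?K" "y \<in> ?K" for x y
  proof -
    obtain u v w u' v' w' where "x = qcomb \<alpha> u v w" "y = qcomb \<alpha> u' v' w'"
      using xy by blast
    then show ?thesis using qcomb_add qcomb_mult by blast
  qed
  moreover have "- x \<in> ?K \<and> inverse x \<in> ?K" if xin: "x \<in> ?K" for x
  proof -
    obtain u v w where x: "x = qcomb \<alpha> u v w" using xin by blast
    have "- x = of_rat (- 1) * x" by simp
    then show ?thesis unfolding x qcomb_scale using qcomb_inverse by blast
  qed
  moreover have "0 \<in> ?K" "1 \<in> ?K"
    using qcomb_of_rat[of 0] qcomb_of_rat[of 1] by (metis (mono_tags, lifting) mem_Collect_eq of_rat_0 of_rat_1)+
  ultimately have "is_subfield ?K" unfolding is_subfield_def by blast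
  moreover have "\<alpha> = qcomb \<alpha> 0 1 0" by (simp add: qcomb_def)
  then have "\<alpha> \<in> ?K" by blast
  ultimately show "rat_adjoin \<alpha> \<subseteq> ?K" unfolding rat_adjoin_def by blast
next
  have "qcomb \<alpha> u v w \<in> K" if "is_subfield K" "\<alpha> \<in> K" for u v w K
    using is_subfield_of_rat[OF that(1)] that
    unfolding qcomb_def power2_eq_square by (simp add: is_subfield_def)
  then show "?K \<subseteq> rat_adjoin \<alpha>" unfolding rat_adjoin_def by blast
qed

end

section \<open>Degree three: linear independence of the powers of \<open>\<alpha>\<close>\<close>

locale cubic_generator = cubic_root +
  assumes qcomb_eq_0: "qcomb \<alpha> u v w = 0 \<Longrightarrow> u = 0 \<and> v = 0 \<and> w = 0"

text \<open>A relation that involves \<open>\<alpha>\<close> can be solved for its highest power of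
  \<open>\<alpha>\<close>, so at most two elements would span the field, against dimension
  3.\<close>

lemma (in cubic_root) cubic_generator_if_cubic_field:
  assumes "is_cubic_number_field (rat_adjoin \<alpha>)"
  shows "cubic_generator \<alpha> a b"
proof
  fix u v w assume eq: "qcomb \<alpha> u v w = 0"
  have dim: "rat_lin.dim (rat_adjoin \<alpha>) = 3"
    using assms by (simp add: is_cubic_number_field_def)
  have small: "\<not> rat_adjoin \<alpha> \<subseteq> rat_lin.span T" if "finite T" "card T \<le> 2" for T
    using rat_lin.dim_le_card[of "rat_adjoin \<alpha>" T] dim that by auto
  have sub: "rat_adjoin \<alpha> \<subseteq> rat_lin.span T"
    if "1 \<in> rat_lin.span T" "\<alpha> \<in> rat_lin.span T" "\<alpha> ^ 2 \<in> rat_lin.span T" for T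
  proof
    fix x assume "x \<in> rat_adjoin \<alpha>"
    then obtain r s t where x: "x = of_rat r * 1 + of_rat s * \<alpha> + of_rat t * \<alpha> ^ 2"
      unfolding rat_adjoin_eq qcomb_def by auto
    show "x \<in> rat_lin.span T"
      unfolding x by (intro rat_lin.span_add rat_lin.span_scale that)
  qed
  have w: "w = 0"
  proof (rule ccontr)
    assume w: "w \<noteq> 0"
    have "of_rat w * qcomb \<alpha> 0 0 1 = qcomb \<alpha> u v w + of_rat w * qcomb \<alpha> (- u / w) (- v / w) 0"
      unfolding qcomb_scale qcomb_add using w by simp
    then have "of_rat w * \<alpha> ^ 2 = of_rat w * (of_rat (- u / w) * 1 + of_rat (- v / w) * \<alpha>)"
      unfolding eq by (simp add: qcomb_def)
    then have "\<alpha> ^ 2 = of_rat (- u / w) * 1 + of_rat (- v / w) * \<alpha>"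
      using w by simp
    also have "\<dots> \<in> rat_lin.span {1, \<alpha>}"
      by (intro rat_lin.span_add rat_lin.span_scale rat_lin.span_base) auto
    \<comment> \<open>\<open>card_length\<close> gives at most two elements even before
      \<open>1\<close> and \<open>\<alpha>\<close> are known to differ.\<close>
    finally show False
      using small[of "{1, \<alpha>}"] sub[of "{1, \<alpha>}"] card_length[of "[1, \<alpha>]"]
      by (simp add: rat_lin.span_base)
  qed
  have v: "v = 0"
  proof (rule ccontr)
    assume v: "v \<noteq> 0"
    have "of_rat v * \<alpha> = of_rat v * (of_rat (- u / v))"
      using eq v w by (simp add: qcomb_def of_rat_divide of_rat_minus field_simps eq_neg_iff_add_eq_0)
    then have \<alpha>: "\<alpha> = of_rat (- u / v) * 1"
      using v by simp
    then have \<alpha>1: "\<alpha> \<in> rat_lin.span {1}"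
      by (metis rat_lin.span_base rat_lin.span_scale singletonI)
    have "\<alpha> ^ 2 = of_rat (- u / v) * \<alpha>"
      using \<alpha> by (simp only: power2_eq_square mult_1_right)
    then have "\<alpha> ^ 2 \<in> rat_lin.span {1}"
      using rat_lin.span_scale[OF \<alpha>1] by metis
    then show False
      using small[of "{1}"] sub[of "{1}"] \<alpha>1 by (simp add: rat_lin.span_base)
  qed
  show "u = 0 \<and> v = 0 \<and> w = 0" using eq v w by (simp add: qcomb_def)
qed

context cubic_generator
begin

lemma qcomb_eq_iff: "qcomb \<alpha> u v w = qcomb \<alpha> u' v' w' \<longleftrightarrow> u = u' \<and> v = v' \<and> w = w'"
proof
  assume "qcomb \<alpha> u v w = qcomb \<alpha> u' v' w'"
  moreover have "qcomb \<alpha> u v w = qcomb \<alpha> u' v' w' + qcomb \<alpha> (u - u') (v - v') (w - w')"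
    unfolding qcomb_add by simp
  ultimately have "qcomb \<alpha> (u - u') (v - v') (w - w') = 0" by simp
  from qcomb_eq_0[OF this] show "u = u' \<and> v = v' \<and> w = w'" by simp
qed simp

lemma zcomb_eq_iff: "zcomb \<alpha> u v w = zcomb \<alpha> u' v' w' \<longleftrightarrow> u = u' \<and> v = v' \<and> w = w'"
  by (simp add: zcomb_eq_qcomb qcomb_eq_iff)

text \<open>Sums over the set \<open>{1, \<alpha>, \<alpha> ^ 2}\<close> split into three summands
  only when its elements are distinct.\<close>

lemma distinct_powers: "1 \<noteq> \<alpha>" "1 \<noteq> \<alpha> ^ 2" "\<alpha> \<noteq> \<alpha> ^ 2"
  using qcomb_eq_iff[of 1 0 0 0 1 0] qcomb_eq_iff[of 1 0 0 0 0 1] qcomb_eq_iff[of 0 1 0 0 0 1]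
  by (simp_all add: qcomb_def)

lemma int_span_powers: "int_lin.span {1, \<alpha>, \<alpha> ^ 2} = int_adjoin \<alpha>"
proof -
  have sum: "(\<Sum>x\<in>{1, \<alpha>, \<alpha> ^ 2}. of_int (c x) * x) = zcomb \<alpha> (c 1) (c \<alpha>) (c (\<alpha> ^ 2))" for c
    using distinct_powers by (simp add: zcomb_def)
  have ex: "\<exists>c. zcomb \<alpha> u v w = zcomb \<alpha> (c 1) (c \<alpha>) (c (\<alpha> ^ 2))" for u v w
    using distinct_powers
    by (intro exI[of _ "\<lambda>x. if x = 1 then u else if x = \<alpha> then v else w"]) simp
  have "int_lin.span {1, \<alpha>, \<alpha> ^ 2} = range (\<lambda>c. zcomb \<alpha> (c 1) (c \<alpha>) (c (\<alpha> ^ 2)))"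
    by (subst int_lin.span_finite) (simp, unfold sum, rule refl)
  also have "\<dots> = int_adjoin \<alpha>"
    unfolding int_adjoin_eq using ex by blast
  finally show ?thesis .
qed

lemma int_independent_powers: "int_lin.independent {1, \<alpha>, \<alpha> ^ 2}"
proof -
  have False if c: "x \<in> {1, \<alpha>, \<alpha> ^ 2}" "c x \<noteq> 0" "(\<Sum>x\<in>{1, \<alpha>, \<alpha> ^ 2}. of_int (c x) * x) = 0" for c x
  proof -
    have "zcomb \<alpha> (c 1) (c \<alpha>) (c (\<alpha> ^ 2)) = zcomb \<alpha> 0 0 0"
      using c(3) distinct_powers by (simp add: zcomb_def add.assoc)
    then show False using c(1,2) by (auto simp: zcomb_eq_iff)
  qed
  then show ?thesis by (subst int_lin.dependent_finite) auto
qed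

lemma is_integral_basis_powers_iff:
  "is_integral_basis L {1, \<alpha>, \<alpha> ^ 2} \<longleftrightarrow> ring_of_integers L = int_adjoin \<alpha>"
  unfolding is_integral_basis_def int_span_powers using int_independent_powers by auto

end

subsection \<open>Integral elements with denominator \<open>p\<close>\<close>

lemma algebraic_int_divide_add:
  fixes x y c :: "'a :: field_char_0"
  shows "algebraic_int (x / c) \<Longrightarrow> algebraic_int (y / c) \<Longrightarrow> algebraic_int ((x + y) / c)"
  unfolding add_divide_distrib by (rule algebraic_int_add)

lemma algebraic_int_divide_mult:
  fixes x y c :: "'a :: field_char_0"
  shows "algebraic_int x \<Longrightarrow> algebraic_int (y / c) \<Longrightarrow> algebraic_int (x * y / c)"
  unfolding times_divide_eq_right[symmetric] by (rule algebraic_int_mult)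

lemma algebraic_int_dvd_divide:
  assumes "m dvd n"
  shows "algebraic_int (of_int n / of_int m :: 'a :: field_char_0)"
  using assms by (cases "m = 0") (auto elim!: dvdE)

lemma prime_int_inverse:
  fixes p k :: int
  assumes "prime p" "\<not> p dvd k"
  obtains m l where "m * k = 1 + p * l"
proof -
  have "coprime k p" using assms prime_imp_coprime[of p k] by (simp add: coprime_commute)
  then obtain m where "[k * m = 1] (mod p)" using cong_solve_coprime_int by blast
  then obtain l where "k * m - 1 = p * l" by (auto simp: cong_iff_dvd_diff elim: dvdE)
  then show thesis using that[of m l] by (simp add: algebra_simps)
qed

text \<open>An inverse \<open>m\<close> of \<open>k\<close> modulo \<open>p\<close>, with
  \<open>m * k = 1 + p * l\<close>, gives \<open>x / p = m * (k * x / p) - l * x\<close>.\<close>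

lemma algebraic_int_divide_cancel:
  fixes x :: "'a :: field_char_0"
  assumes "prime p" "\<not> p dvd k" "algebraic_int x" "algebraic_int (of_int k * x / of_int p)"
  shows "algebraic_int (x / of_int p)"
proof -
  obtain m l where ml: "m * k = 1 + p * l" using prime_int_inverse[OF assms(1,2)] .
  have "p \<noteq> 0" using assms(1) by auto
  have "of_int (m * k) * x = x + of_int (p * l) * x"
    unfolding ml by (simp add: distrib_right)
  then have "x / of_int p = of_int m * (of_int k * x / of_int p) - of_int l * x"
    using \<open>p \<noteq> 0\<close> by (simp add: field_simps)
  also have "algebraic_int \<dots>"
    by (intro algebraic_int_diff algebraic_int_mult algebraic_int_of_int assms)
  finally show ?thesis .
qed

lemma algebraic_int_cubic:
  fixes x :: "'a :: field_char_0"
  assumes "of_int c + of_int d * x + of_int e * x ^ 2 + x ^ 3 = 0"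
  shows "algebraic_int x"
proof -
  have "poly (map_poly of_int [:c, d, e, 1:]) x = 0"
    using assms by (simp add: of_int_hom.map_poly_pCons_hom distrib_left distrib_right
        power2_eq_square power3_eq_cube mult_ac add.assoc)
  then show ?thesis
    unfolding algebraic_int_altdef_ipoly by (intro exI[of _ "[:c, d, e, 1:]"]) simp
qed

context cubic_root
begin

text \<open>The monic equation of \<open>x / p\<close>, multiplied by \<open>p ^ n\<close>, leaves
  at least one factor \<open>p\<close> in every lower term. So \<open>x\<close> is nilpotent modulo
  \<open>p\<close>.\<close>

lemma power_eq_if_algebraic_int_divide:
  assumes x: "x \<in> int_adjoin \<alpha>" and p: "p \<noteq> 0" and int: "algebraic_int (x / of_int p)"
  obtains n g where "g \<in> int_adjoin \<alpha>" "x ^ n = of_int p * g"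
proof -
  obtain n c where n: "n > 0" and eq: "(x / of_int p) ^ n = (\<Sum>i<n. of_int (c i) * (x / of_int p) ^ i)"
    using algebraic_int_power_eq[OF int] .
  have "x ^ n = of_int p ^ n * (x / of_int p) ^ n"
    using p by (simp add: power_divide)
  also have "\<dots> = (\<Sum>i<n. of_int p * (of_int (c i * p ^ (n - Suc i)) * x ^ i))"
    unfolding eq sum_distrib_left
  proof (rule sum.cong)
    fix i assume "i \<in> {..<n}"
    then have "p ^ n = p * p ^ (n - Suc i) * p ^ i"
      by (metis Suc_diff_Suc lessThan_iff less_imp_le_nat le_add_diff_inverse2 power_Suc power_add)
    then have pn: "(of_int p :: 'a) ^ n = of_int p * of_int (p ^ (n - Suc i)) * of_int p ^ i"
      by (metis of_int_mult of_int_power)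
    show "of_int p ^ n * (of_int (c i) * (x / of_int p) ^ i) =
        of_int p * (of_int (c i * p ^ (n - Suc i)) * x ^ i)"
      unfolding pn using p by (simp add: power_divide)
  qed simp
  also have "\<dots> = of_int p * (\<Sum>i<n. of_int (c i * p ^ (n - Suc i)) * x ^ i)"
    by (simp only: sum_distrib_left)
  finally show thesis
    by (rule that[rotated]) (intro int_adjoin_sum int_adjoin_mult int_adjoin_of_int int_adjoin_power x)
qed

text \<open>Reduction modulo \<open>p\<close> at a root \<open>r\<close> of \<open>f\<close> modulo \<open>p\<close> is multiplicative.\<close>

lemma zcomb_power_eval:
  assumes r: "p dvd r ^ 3 - a * r + b"
  shows "\<exists>u' v' w'. zcomb \<alpha> u v w ^ n = zcomb \<alpha> u' v' w' \<and>
    [u' + v' * r + w' * r ^ 2 = (u + v * r + w * r ^ 2) ^ n] (mod p)"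
proof (induction n)
  case 0
  show ?case by (rule exI[of _ 1], rule exI[of _ 0], rule exI[of _ 0]) (simp add: zcomb_def)
next
  case (Suc n)
  then obtain u' v' w' where eq: "zcomb \<alpha> u v w ^ n = zcomb \<alpha> u' v' w'"
    and ev: "[u' + v' * r + w' * r ^ 2 = (u + v * r + w * r ^ 2) ^ n] (mod p)"
    by blast
  define U V W where "U = u * u' - b * (v * w' + w * v')"
    and "V = u * v' + v * u' + a * (v * w' + w * v') - b * w * w'"
    and "W = u * w' + v * v' + w * u' + a * w * w'"
  have "(u + v * r + w * r ^ 2) * (u' + v' * r + w' * r ^ 2) =
      U + V * r + W * r ^ 2 + (v * w' + w * v' + w * w' * r) * (r ^ 3 - a * r + b)"
    unfolding U_def V_def W_def by (simp add: algebra_simps power2_eq_square power3_eq_cube)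
  then have "[U + V * r + W * r ^ 2 = (u + v * r + w * r ^ 2) * (u' + v' * r + w' * r ^ 2)] (mod p)"
    using r by (simp add: cong_iff_dvd_diff)
  also have "[(u + v * r + w * r ^ 2) * (u' + v' * r + w' * r ^ 2) = 
      (u + v * r + w * r ^ 2) * (u + v * r + w * r ^ 2) ^ n] (mod p)"
    by (rule cong_scalar_left[OF ev])
  finally have "[U + V * r + W * r ^ 2 = (u + v * r + w * r ^ 2) ^ Suc n] (mod p)" by simp
  moreover have "zcomb \<alpha> u v w ^ Suc n = zcomb \<alpha> U V W"
    unfolding power_Suc eq zcomb_mult U_def V_def W_def ..
  ultimately show ?case by blast
qed

text \<open>This is the factorisation of \<open>f(\<alpha>) - f(r)\<close> by
  \<open>\<alpha> - r\<close>, with \<open>f(\<alpha>) = 0\<close>. The second factor is the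
  cofactor.\<close>

lemma linear_mult_cofactor:
  "(\<alpha> - of_int r) * zcomb \<alpha> (r ^ 2 - a) r 1 = - of_int (r ^ 3 - a * r + b)"
proof -
  have "\<alpha> - of_int r = zcomb \<alpha> (- r) 1 0" by (simp add: zcomb_def)
  then have "(\<alpha> - of_int r) * zcomb \<alpha> (r ^ 2 - a) r 1 = zcomb \<alpha> (- (r ^ 3 - a * r + b)) 0 0"
    by (simp only: zcomb_mult) (simp add: algebra_simps power2_eq_square power3_eq_cube)
  then show ?thesis by (simp add: zcomb_def)
qed

text \<open>The Taylor expansion of the cofactor at \<open>r\<close>; the lower coefficients are
  \<open>f''(r) / 2\<close> and \<open>f'(r)\<close>.\<close>

lemma cofactor_eq:
  "zcomb \<alpha> (r ^ 2 - a) r 1 =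
     (\<alpha> - of_int r) ^ 2 + of_int (3 * r) * (\<alpha> - of_int r) + of_int (3 * r ^ 2 - a)"
proof -
  define R A where "R = (of_int r :: 'a)" and "A = (of_int a :: 'a)"
  have "R ^ 2 - A + R * \<alpha> + \<alpha> ^ 2 = (\<alpha> - R) ^ 2 + 3 * R * (\<alpha> - R) + (3 * R ^ 2 - A)"
    by (simp add: algebra_simps power2_eq_square)
  then show ?thesis
    by (simp add: zcomb_def R_def A_def)
qed

text \<open>With \<open>f(r) = p^2 C\<close> and \<open>f'(r) = p D\<close>, the quotient
  \<open>\<gamma>\<close> and \<open>\<beta> = \<alpha> - r\<close> satisfy
  \<open>\<beta> * \<gamma> = - p C\<close>. Multiplying the expansion of
  \<open>p * \<gamma>\<close> by \<open>\<gamma>\<close>, cancelling \<open>p\<close>, and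
  multiplying by \<open>\<gamma>\<close> again eliminates \<open>\<beta>\<close> and leaves a monic
  integer cubic for \<open>\<gamma>\<close>.\<close>

lemma algebraic_int_cofactor_divide:
  assumes p: "p \<noteq> 0" and d: "p dvd 3 * r ^ 2 - a" and c: "p ^ 2 dvd r ^ 3 - a * r + b"
  shows "algebraic_int (zcomb \<alpha> (r ^ 2 - a) r 1 / of_int p)"
proof -
  define \<beta> \<gamma> where "\<beta> = \<alpha> - of_int r" and "\<gamma> = zcomb \<alpha> (r ^ 2 - a) r 1 / of_int p"
  obtain C D where C: "r ^ 3 - a * r + b = p ^ 2 * C" and D: "3 * r ^ 2 - a = p * D"
    using c d by (auto elim!: dvdE)
  define P Ci Di E where "P = (of_int p :: 'a)" and "Ci = (of_int C :: 'a)"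
    and "Di = (of_int D :: 'a)" and "E = (of_int (3 * r) :: 'a)"
  have P: "P \<noteq> 0" using p by (simp add: P_def)
  have \<gamma>: "P * \<gamma> = \<beta> ^ 2 + E * \<beta> + P * Di"
    using p cofactor_eq[of r] unfolding D by (simp add: \<gamma>_def \<beta>_def P_def Di_def E_def)
  have "P * (\<beta> * \<gamma>) = P * (- (P * Ci))"
  proof -
    have "P * \<gamma> = zcomb \<alpha> (r ^ 2 - a) r 1" using p by (simp add: \<gamma>_def P_def)
    then have "\<beta> * (P * \<gamma>) = - of_int (p ^ 2 * C)"
      by (simp only: \<beta>_def linear_mult_cofactor C)
    also have "\<dots> = P * (- (P * Ci))"
      by (simp add: P_def Ci_def power2_eq_square)
    finally show ?thesis by (simp only: mult.left_commute)
  qed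
  then have bg: "\<beta> * \<gamma> = - (P * Ci)" using P by (simp only: mult_cancel_left) simp
  have "P * \<gamma> ^ 2 = P * (- (Ci * \<beta>) - E * Ci + Di * \<gamma>)"
  proof -
    have "P * \<gamma> ^ 2 = (P * \<gamma>) * \<gamma>" by (simp add: power2_eq_square)
    also have "\<dots> = \<beta> * (\<beta> * \<gamma>) + E * (\<beta> * \<gamma>) + P * Di * \<gamma>"
      unfolding \<gamma> by (simp add: algebra_simps power2_eq_square)
    finally show ?thesis unfolding bg by (simp add: algebra_simps)
  qed
  then have g2: "\<gamma> ^ 2 = - (Ci * \<beta>) - E * Ci + Di * \<gamma>" using P by (simp only: mult_cancel_left) simp
  have "- (P * Ci ^ 2) + E * Ci * \<gamma> + - Di * \<gamma> ^ 2 + \<gamma> ^ 3 = 0"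
  proof -
    have "\<gamma> ^ 3 = \<gamma> * \<gamma> ^ 2" by (simp add: power3_eq_cube power2_eq_square)
    also have "\<dots> = \<gamma> * (- (Ci * \<beta>) - E * Ci + Di * \<gamma>)"
      by (simp only: g2)
    also have "\<dots> = - (Ci * (\<beta> * \<gamma>)) - E * Ci * \<gamma> + Di * \<gamma> ^ 2"
      by (simp add: algebra_simps power2_eq_square)
    finally show ?thesis unfolding bg by (simp add: algebra_simps power2_eq_square)
  qed
  then have "of_int (- (p * C ^ 2)) + of_int (3 * r * C) * \<gamma> + of_int (- D) * \<gamma> ^ 2 + \<gamma> ^ 3 = 0"
    by (simp only: P_def Ci_def Di_def E_def of_int_mult of_int_minus of_int_power)
  then show ?thesis
    unfolding \<gamma>_def[symmetric] by (rule algebraic_int_cubic)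
qed

end

context cubic_generator
begin

lemma dvd_if_zcomb_eq:
  assumes "zcomb \<alpha> u v w = of_int p * g" "g \<in> int_adjoin \<alpha>"
  shows "p dvd u \<and> p dvd v \<and> p dvd w"
  using assms(2) by (rule int_adjoinE) (use assms(1) in \<open>simp add: zcomb_scale zcomb_eq_iff\<close>)

text \<open>Some power of the numerator lies in \<open>p \<int>[\<alpha>]\<close>. Reduction at the
  root \<open>r\<close> makes the same power of its value at \<open>r\<close> divisible by
  \<open>p\<close>, and \<open>p\<close> is prime.\<close>

lemma dvd_eval_if_algebraic_int_divide:
  assumes p: "prime p" and r: "p dvd r ^ 3 - a * r + b"
    and int: "algebraic_int (zcomb \<alpha> u v w / of_int p)"
  shows "p dvd u + v * r + w * r ^ 2"
proof -
  have "p \<noteq> 0" using p by auto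
  obtain n g where g: "g \<in> int_adjoin \<alpha>" "zcomb \<alpha> u v w ^ n = of_int p * g"
    using power_eq_if_algebraic_int_divide[OF zcomb_in \<open>p \<noteq> 0\<close> int] .
  obtain u' v' w' where "zcomb \<alpha> u v w ^ n = zcomb \<alpha> u' v' w'"
    and ev: "[u' + v' * r + w' * r ^ 2 = (u + v * r + w * r ^ 2) ^ n] (mod p)"
    using zcomb_power_eval[OF r] by blast
  then have "p dvd u' \<and> p dvd v' \<and> p dvd w'" using dvd_if_zcomb_eq g by metis
  then have "p dvd u' + v' * r + w' * r ^ 2" by simp
  then have "p dvd (u + v * r + w * r ^ 2) ^ n" using cong_dvd_iff ev cong_sym by blast
  then show ?thesis using p prime_dvd_power by blast
qed

text \<open>Multiplying by the cofactor shows that \<open>f(r) / p\<close> is integral, hence the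
  first claim. The second holds because \<open>\<alpha> - r\<close> is nilpotent modulo
  \<open>p\<close>, which a simple root \<open>r\<close> would not allow.\<close>

lemma linear_divide_dvd:
  assumes p: "prime p" and int: "algebraic_int ((\<alpha> - of_int r) / of_int p)"
  shows "p dvd r ^ 3 - a * r + b" "p dvd 3 * r ^ 2 - a"
proof -
  have p0: "p \<noteq> 0" and np1: "\<not> p dvd 1" using p by auto
  define \<beta> where "\<beta> = \<alpha> - of_int r"
  have \<beta>: "\<beta> = zcomb \<alpha> (- r) 1 0" by (simp add: \<beta>_def zcomb_def)
  have \<beta>in: "\<beta> \<in> int_adjoin \<alpha>" by (simp add: \<beta> zcomb_in)
  have "algebraic_int (zcomb \<alpha> (r ^ 2 - a) r 1 * \<beta> / of_int p)"
    by (intro algebraic_int_divide_mult algebraic_int_zcomb int[folded \<beta>_def])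
  then have "algebraic_int (of_int (r ^ 3 - a * r + b) / of_int p :: 'a)"
    by (simp only: \<beta>_def mult.commute[of "zcomb _ _ _ _"] linear_mult_cofactor
        minus_divide_left[symmetric] algebraic_int_minus_iff)
  then show c: "p dvd r ^ 3 - a * r + b"
    using algebraic_int_of_int_divide p0 by blast
  then obtain C where C: "r ^ 3 - a * r + b = p * C" by (auto elim: dvdE)
  show "p dvd 3 * r ^ 2 - a"
  proof (rule ccontr)
    assume nd: "\<not> p dvd 3 * r ^ 2 - a"
    then obtain k l where kl: "k * (3 * r ^ 2 - a) = 1 + p * l"
      using prime_int_inverse[OF p] by blast
    txt \<open>
      Multiplying \<open>f(\<alpha>) = 0\<close>, expanded in powers of \<open>\<beta>\<close>, by \<open>\<beta> ^ m\<close> shows that the least power of \<open>\<beta>\<close>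
      divisible by \<open>p\<close> could be lowered if \<open>f'(r)\<close> were invertible modulo \<open>p\<close>.
    \<close>
    define Q where "Q n \<longleftrightarrow> (\<exists>g\<in>int_adjoin \<alpha>. \<beta> ^ n = of_int p * g)" for n
    have "\<exists>n. Q n"
      using power_eq_if_algebraic_int_divide[OF \<beta>in p0 int[folded \<beta>_def]] unfolding Q_def by metis
    then have least: "Q (LEAST n. Q n)" by (rule LeastI_ex)
    \<comment> \<open>Neither \<open>1\<close> nor \<open>\<alpha> - r\<close> is divisible by
      \<open>p\<close>, each having a coordinate \<open>1\<close>. So the least exponent is at least
      2 and the \<open>m\<close> below exists.\<close>
    have "\<not> Q 0" "\<not> Q (Suc 0)"
      using np1 dvd_if_zcomb_eq[of 1 0 0 p] dvd_if_zcomb_eq[of "- r" 1 0 p]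
      unfolding Q_def \<beta> by (auto simp: zcomb_def)
    then obtain m where m: "(LEAST n. Q n) = Suc (Suc m)"
      using least by (metis not0_implies_Suc)
    then obtain g where g: "g \<in> int_adjoin \<alpha>" "\<beta> ^ Suc (Suc m) = of_int p * g"
      using least unfolding Q_def by auto
    define P Ci Di E K Li where "P = (of_int p :: 'a)" and "Ci = (of_int C :: 'a)"
      and "Di = (of_int (3 * r ^ 2 - a) :: 'a)" and "E = (of_int (3 * r) :: 'a)"
      and "K = (of_int k :: 'a)" and "Li = (of_int l :: 'a)"
    have "\<beta> * (\<beta> ^ 2 + E * \<beta> + Di) = - (P * Ci)"
      using linear_mult_cofactor[of r] unfolding cofactor_eq C
      by (simp add: \<beta>_def E_def Di_def P_def Ci_def)
    then have "Di * \<beta> = - (P * Ci) - \<beta> * \<beta> ^ 2 - E * \<beta> ^ 2"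
      by (simp add: algebra_simps power2_eq_square)
    then have "\<beta> ^ m * (Di * \<beta>) = \<beta> ^ m * (- (P * Ci) - \<beta> * \<beta> ^ 2 - E * \<beta> ^ 2)" by simp
    also have "\<dots> = - (P * (Ci * \<beta> ^ m)) - \<beta> * (\<beta> ^ m * \<beta> ^ 2) - E * (\<beta> ^ m * \<beta> ^ 2)"
      by (simp add: algebra_simps)
    also have "\<beta> ^ m * \<beta> ^ 2 = P * g"
      using g(2) by (simp add: P_def power2_eq_square mult_ac)
    finally have D\<beta>: "\<beta> ^ m * (Di * \<beta>) = P * (- (Ci * \<beta> ^ m) - \<beta> * g - E * g)"
      by (simp add: algebra_simps)
    have KD: "K * Di = 1 + P * Li"
      unfolding K_def Di_def P_def Li_def of_int_mult[symmetric] kl by simp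
    \<comment> \<open>\<open>K\<close> inverts \<open>Di\<close> modulo \<open>P\<close>, so
      \<open>Di\<close> can be removed from \<open>D\<beta>\<close> up to a multiple of
      \<open>P\<close>.\<close>
    have "\<beta> ^ m * \<beta> = (1 + P * Li) * (\<beta> ^ m * \<beta>) - P * (Li * \<beta> ^ m * \<beta>)"
      by (simp add: algebra_simps)
    also have "\<dots> = K * (\<beta> ^ m * (Di * \<beta>)) - P * (Li * \<beta> ^ m * \<beta>)"
      unfolding KD[symmetric] by (simp only: mult_ac)
    finally have "\<beta> ^ m * \<beta> = P * (K * (- (Ci * \<beta> ^ m) - \<beta> * g - E * g) - Li * \<beta> ^ m * \<beta>)"
      unfolding D\<beta> by (simp add: algebra_simps)
    then have "\<beta> ^ Suc m = of_int p * (K * (- (Ci * \<beta> ^ m) - \<beta> * g - E * g) - Li * \<beta> ^ m * \<beta>)"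
      by (simp add: P_def mult.commute)
    moreover have "- (Ci * \<beta> ^ m) = of_int (- C) * \<beta> ^ m" by (simp add: Ci_def)
    then have "K * (- (Ci * \<beta> ^ m) - \<beta> * g - E * g) - Li * \<beta> ^ m * \<beta> \<in> int_adjoin \<alpha>"
      unfolding K_def E_def Li_def
      by (auto simp only: intro!: int_adjoin_diff int_adjoin_mult int_adjoin_of_int int_adjoin_power g \<beta>in)
    ultimately have "Q (Suc m)" unfolding Q_def by blast
    then have "(LEAST n. Q n) \<le> Suc m" by (rule Least_le)
    then show False using m by simp
  qed
qed

text \<open>A partial converse of \<open>algebraic_int_cofactor_divide\<close>. Write
  \<open>f(r) = p C\<close>, so that \<open>\<beta> * \<gamma> = - C\<close>. If \<open>p\<close>
  did not divide \<open>C\<close>, integrality of \<open>\<gamma>\<close> would pass to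
  \<open>(\<beta> + 3 r) / p\<close>, then to \<open>\<beta> / p\<close>, and then to
  \<open>\<gamma> * (- \<beta> / p) = C / p\<close>, which is impossible.\<close>

lemma cofactor_divide_dvd:
  assumes p: "prime p" and int: "algebraic_int (zcomb \<alpha> (r ^ 2 - a) r 1 / of_int p)"
    and c: "p dvd r ^ 3 - a * r + b" and d: "p dvd 3 * r ^ 2 - a"
  shows "p ^ 2 dvd r ^ 3 - a * r + b"
proof -
  have p0: "p \<noteq> 0" using p by auto
  define \<beta> \<gamma> where "\<beta> = \<alpha> - of_int r" and "\<gamma> = zcomb \<alpha> (r ^ 2 - a) r 1 / of_int p"
  obtain C D where C: "r ^ 3 - a * r + b = p * C" and D: "3 * r ^ 2 - a = p * D"
    using c d by (auto elim!: dvdE)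
  have "p dvd C"
  proof (rule ccontr)
    assume nC: "\<not> p dvd C"
    define P Ci Di E where "P = (of_int p :: 'a)" and "Ci = (of_int C :: 'a)"
      and "Di = (of_int D :: 'a)" and "E = (of_int (3 * r) :: 'a)"
    have P: "P \<noteq> 0" using p0 by (simp add: P_def)
    have \<gamma>: "P * \<gamma> = \<beta> ^ 2 + E * \<beta> + P * Di"
      using p0 cofactor_eq[of r] unfolding D by (simp add: \<gamma>_def \<beta>_def P_def Di_def E_def)
    have "P * (\<beta> * \<gamma>) = P * (- Ci)"
    proof -
      have "P * \<gamma> = zcomb \<alpha> (r ^ 2 - a) r 1" using p0 by (simp add: \<gamma>_def P_def)
      then have "\<beta> * (P * \<gamma>) = - of_int (p * C)"
        by (simp only: \<beta>_def linear_mult_cofactor C)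
      also have "\<dots> = P * (- Ci)"
        by (simp add: P_def Ci_def)
      finally show ?thesis by (simp only: mult.left_commute)
    qed
    then have bg: "\<beta> * \<gamma> = - Ci" using P by (simp only: mult_cancel_left) simp
    have "Ci * (\<beta> + E) = P * (Di * \<gamma> - \<gamma> ^ 2)"
    proof -
      have "Ci * (\<beta> + E) = - (\<gamma> * (\<beta> ^ 2 + E * \<beta>))"
        using bg by (simp add: algebra_simps power2_eq_square minus_equation_iff[of _ Ci])
      also have "\<beta> ^ 2 + E * \<beta> = P * \<gamma> - P * Di" using \<gamma> by simp
      finally show ?thesis by (simp add: algebra_simps power2_eq_square)
    qed
    then have eq: "Ci * (\<beta> + E) / P = Di * \<gamma> - \<gamma> ^ 2" using P by simp
    have \<gamma>int: "algebraic_int \<gamma>" using int by (simp add: \<gamma>_def)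
    have "algebraic_int (Ci * (\<beta> + E) / P)"
      unfolding eq Di_def power2_eq_square
      by (intro algebraic_int_diff algebraic_int_mult algebraic_int_of_int \<gamma>int)
    moreover have \<beta>E: "\<beta> + E = zcomb \<alpha> (2 * r) 1 0"
      by (simp add: \<beta>_def E_def zcomb_def)
    ultimately have int2: "algebraic_int ((\<beta> + E) / P)"
      using algebraic_int_divide_cancel[OF p nC algebraic_int_zcomb, of "2 * r" 1 0] by (simp add: Ci_def P_def)
    \<comment> \<open>\<open>\<beta> + E\<close> is \<open>\<alpha> + 2 r\<close>, whose value at
      \<open>r\<close> is \<open>3 r\<close>.\<close>
    then have "p dvd 2 * r + 1 * r + 0 * r ^ 2"
      using dvd_eval_if_algebraic_int_divide[OF p c] unfolding \<beta>E P_def by blast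
    then have "algebraic_int (E / P)"
      unfolding E_def P_def by (intro algebraic_int_dvd_divide) simp
    then have "algebraic_int ((\<beta> + E) / P - E / P)"
      by (intro algebraic_int_diff int2)
    then have "algebraic_int (\<gamma> * (- \<beta> / P))"
      using \<gamma>int by (intro algebraic_int_mult) (simp_all add: add_divide_distrib)
    moreover have "\<gamma> * (- \<beta> / P) = Ci / P" using bg by (simp add: mult.commute)
    ultimately have "p dvd C"
      using algebraic_int_of_int_divide p0 unfolding Ci_def P_def by metis
    with nC show False ..
  qed
  then show ?thesis unfolding C by (simp add: power2_eq_square)
qed

text \<open>Scaling by an inverse of \<open>v\<close> modulo \<open>p\<close> turns the numerator
  into \<open>\<alpha> - r\<close>. Then \<open>p\<close> divides \<open>f(r)\<close> and
  \<open>f'(r)\<close>, and the cofactor, equal to \<open>(\<beta> + 3 r) \<beta> + f'(r)\<close>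
  with \<open>\<beta> = \<alpha> - r\<close>, is also \<open>p\<close> times an algebraic integer;
  \<open>cofactor_divide_dvd\<close> gives the square.\<close>

lemma double_root_if_linear:
  assumes p: "prime p" and int: "algebraic_int (zcomb \<alpha> u v 0 / of_int p)"
    and nd: "\<not> (p dvd u \<and> p dvd v)"
  shows "\<exists>r. p dvd 3 * r ^ 2 - a \<and> p ^ 2 dvd r ^ 3 - a * r + b"
proof -
  have p0: "p \<noteq> 0" using p by auto
  have nv: "\<not> p dvd v"
  proof
    assume v: "p dvd v"
    have "algebraic_int ((zcomb \<alpha> u v 0 + of_int (- v) * \<alpha>) / of_int p)"
      using algebraic_int_mult[OF algebraic_int_dvd_divide algebraic_int_alpha, of p "- v"] v
      by (intro algebraic_int_divide_add int) simp
    then have "algebraic_int (of_int u / of_int p :: 'a)" by (simp add: zcomb_def)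
    then have "p dvd u" using algebraic_int_of_int_divide p0 by blast
    with v nd show False by blast
  qed
  then obtain k l where kl: "k * v = 1 + p * l" using prime_int_inverse[OF p] by blast
  define r where "r = - (k * u)"
  have "of_int k * zcomb \<alpha> u v 0 + of_int p * (of_int (- l) * \<alpha>) = \<alpha> - of_int r"
    unfolding zcomb_scale kl by (simp add: zcomb_def r_def distrib_right)
  moreover have "algebraic_int ((of_int k * zcomb \<alpha> u v 0 + of_int p * (of_int (- l) * \<alpha>)) / of_int p)"
    using p0 algebraic_int_mult[OF algebraic_int_of_int algebraic_int_alpha, of "- l"]
    by (intro algebraic_int_divide_add[OF algebraic_int_divide_mult[OF algebraic_int_of_int int]]) simp
  ultimately have int_r: "algebraic_int ((\<alpha> - of_int r) / of_int p)" by simp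
  note dvd = linear_divide_dvd[OF p int_r]
  have "algebraic_int (((\<alpha> - of_int r + of_int (3 * r)) * (\<alpha> - of_int r) + of_int (3 * r ^ 2 - a)) / of_int p)"
    using algebraic_int_zcomb[of "2 * r" 1 0] int_r
    by (intro algebraic_int_divide_add algebraic_int_divide_mult algebraic_int_dvd_divide dvd)
      (simp_all add: zcomb_def)
  then have "algebraic_int (zcomb \<alpha> (r ^ 2 - a) r 1 / of_int p)"
    unfolding cofactor_eq by (simp only: power2_eq_square distrib_right)
  from cofactor_divide_dvd[OF p this dvd] dvd show ?thesis by blast
qed

text \<open>Multiplication by \<open>\<alpha> - s\<close> cancels the quadratic term. If the
  resulting linear numerator is nonzero modulo \<open>p\<close>, the linear case applies. Otherwise
  \<open>t\<close> agrees with \<open>s^2 - a\<close> modulo \<open>p\<close>, so the numerator is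
  the cofactor at \<open>s\<close>, and \<open>s\<close> is a root of \<open>f\<close> modulo
  \<open>p\<close>.\<close>

lemma double_root_if_quadratic:
  assumes p: "prime p" and int: "algebraic_int (zcomb \<alpha> t s 1 / of_int p)"
  shows "\<exists>r. p dvd 3 * r ^ 2 - a \<and> p ^ 2 dvd r ^ 3 - a * r + b"
proof -
  have eq: "zcomb \<alpha> (- s) 1 0 * zcomb \<alpha> t s 1 = zcomb \<alpha> (- (s * t + b)) (t + a - s ^ 2) 0"
    unfolding zcomb_mult zcomb_eq_iff by (simp add: power2_eq_square)
  have "algebraic_int (zcomb \<alpha> (- s) 1 0 * zcomb \<alpha> t s 1 / of_int p)"
    by (intro algebraic_int_divide_mult algebraic_int_zcomb int)
  then have lin: "algebraic_int (zcomb \<alpha> (- (s * t + b)) (t + a - s ^ 2) 0 / of_int p)"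
    by (simp only: eq)
  show ?thesis
  proof (cases "p dvd - (s * t + b) \<and> p dvd t + a - s ^ 2")
    case False
    then show ?thesis using double_root_if_linear[OF p lin] by blast
  next
    case True
    then have d1: "p dvd s * t + b" by (simp only: dvd_minus_iff)
    have "s ^ 2 - a - t = - (t + a - s ^ 2)" by simp
    then have d2: "p dvd s ^ 2 - a - t" using True by (simp only: dvd_minus_iff)
    have "zcomb \<alpha> (s ^ 2 - a) s 1 = zcomb \<alpha> t s 1 + of_int (s ^ 2 - a - t)"
      by (simp add: zcomb_def)
    then have int_q: "algebraic_int (zcomb \<alpha> (s ^ 2 - a) s 1 / of_int p)"
      using int d2 by (simp only:) (intro algebraic_int_divide_add algebraic_int_dvd_divide)
    have "s ^ 3 - a * s + b = s * (s ^ 2 - a - t) + (s * t + b)"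
      by (simp add: algebra_simps power2_eq_square power3_eq_cube)
    then have c: "p dvd s ^ 3 - a * s + b"
      using dvd_add[OF dvd_mult[OF d2, of s] d1] by (simp only:)
    \<comment> \<open>The value of the cofactor at \<open>s\<close> is \<open>f'(s)\<close>.\<close>
    have "p dvd s ^ 2 - a + s * s + 1 * s ^ 2"
      by (rule dvd_eval_if_algebraic_int_divide[OF p c int_q])
    then have d: "p dvd 3 * s ^ 2 - a" by (simp add: power2_eq_square algebra_simps)
    from cofactor_divide_dvd[OF p int_q c d] d show ?thesis by blast
  qed
qed

lemma double_root_if_not_maximal:
  assumes p: "prime p" and y: "algebraic_int y" "y \<notin> int_adjoin \<alpha>"
    and py: "of_int p * y \<in> int_adjoin \<alpha>"
  shows "\<exists>r. p dvd 3 * r ^ 2 - a \<and> p ^ 2 dvd r ^ 3 - a * r + b"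
proof -
  have p0: "p \<noteq> 0" using p by auto
  obtain u v w where uvw: "of_int p * y = zcomb \<alpha> u v w" using py by (rule int_adjoinE)
  then have y_eq: "y = zcomb \<alpha> u v w / of_int p" using p0 by (simp add: field_simps)
  show ?thesis
  proof (cases "p dvd w")
    case True
    have "algebraic_int ((zcomb \<alpha> u v w + of_int (- w) * \<alpha> ^ 2) / of_int p)"
      using algebraic_int_mult[OF algebraic_int_dvd_divide algebraic_int_zcomb, of p "- w" 0 0 1] True y y_eq
      by (intro algebraic_int_divide_add) (simp_all add: zcomb_def)
    then have int: "algebraic_int (zcomb \<alpha> u v 0 / of_int p)" by (simp add: zcomb_def)
    have "\<not> (p dvd u \<and> p dvd v)"
    proof
      assume "p dvd u \<and> p dvd v"
      then obtain u' v' w' where "u = p * u'" "v = p * v'" "w = p * w'"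
        using True by (auto elim!: dvdE)
      then have "of_int p * y = of_int p * zcomb \<alpha> u' v' w'"
        by (simp only: uvw zcomb_scale)
      then have "y = zcomb \<alpha> u' v' w'" using p0 by simp
      then show False using y zcomb_in by blast
    qed
    then show ?thesis using double_root_if_linear[OF p int] by blast
  next
    case False
    then obtain k l where kl: "k * w = 1 + p * l" using prime_int_inverse[OF p] by blast
    have "of_int k * zcomb \<alpha> u v w + of_int p * (of_int (- l) * \<alpha> ^ 2) = zcomb \<alpha> (k * u) (k * v) 1"
      unfolding zcomb_scale kl by (simp add: zcomb_def distrib_right)
    moreover have "algebraic_int ((of_int k * zcomb \<alpha> u v w + of_int p * (of_int (- l) * \<alpha> ^ 2)) / of_int p)"
      using p0 algebraic_int_zcomb[of 0 0 "- l"]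
      by (intro algebraic_int_divide_add[OF algebraic_int_divide_mult[OF algebraic_int_of_int y(1)[unfolded y_eq]]])
        (simp add: zcomb_def)
    ultimately have "algebraic_int (zcomb \<alpha> (k * u) (k * v) 1 / of_int p)" by simp
    then show ?thesis by (rule double_root_if_quadratic[OF p])
  qed
qed

section \<open>From single primes to arbitrary denominators\<close>

lemma rat_adjoin_denominator:
  assumes "x \<in> rat_adjoin \<alpha>"
  obtains n :: nat where "n > 0" "of_nat n * x \<in> int_adjoin \<alpha>"
proof -
  obtain u v w where x: "x = qcomb \<alpha> u v w" using assms unfolding rat_adjoin_eq by blast
  have "\<exists>n m. n > 0 \<and> rat_of_nat n * q = of_int m" for q
  proof -
    obtain m n where "q = of_int m / of_int n" "n > 0" by (cases q) (auto simp: Fract_of_int_quotient)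
    then show ?thesis by (intro exI[of _ "nat n"] exI[of _ m]) simp
  qed
  then obtain N M where NM: "\<And>q. N q > 0 \<and> rat_of_nat (N q) * q = of_int (M q)" by metis
  define n where "n = N u * N v * N w"
  have "of_nat n * x = of_rat (of_nat n) * x" by simp
  also have "\<dots> = qcomb \<alpha> (of_nat (N v * N w) * (of_nat (N u) * u))
      (of_nat (N u * N w) * (of_nat (N v) * v)) (of_nat (N u * N v) * (of_nat (N w) * w))"
    unfolding x qcomb_scale by (simp add: n_def mult_ac)
  also have "\<dots> = zcomb \<alpha> (int (N v * N w) * M u) (int (N u * N w) * M v) (int (N u * N v) * M w)"
    using NM by (simp add: zcomb_eq_qcomb)
  finally have "of_nat n * x \<in> int_adjoin \<alpha>" by (simp add: zcomb_in)
  moreover have "n > 0" using NM by (simp add: n_def)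
  ultimately show thesis by (rule that[rotated])
qed

text \<open>This is Dedekind's criterion for maximality of the order, specialised to
  \<open>f\<close>.\<close>

theorem ring_of_integers_eq_iff:
  "ring_of_integers (rat_adjoin \<alpha>) = int_adjoin \<alpha> \<longleftrightarrow>
    (\<forall>p::int. prime p \<longrightarrow> \<not> (\<exists>r. p dvd 3 * r ^ 2 - a \<and> p ^ 2 dvd r ^ 3 - a * r + b))"
proof (intro iffI allI impI notI)
  fix p :: int
  assume eq: "ring_of_integers (rat_adjoin \<alpha>) = int_adjoin \<alpha>" and p: "prime p"
    and ex: "\<exists>r. p dvd 3 * r ^ 2 - a \<and> p ^ 2 dvd r ^ 3 - a * r + b"
  then obtain r where r: "p dvd 3 * r ^ 2 - a" "p ^ 2 dvd r ^ 3 - a * r + b" by blast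
  have p0: "p \<noteq> 0" using p by auto
  define \<gamma> where "\<gamma> = zcomb \<alpha> (r ^ 2 - a) r 1 / of_int p"
  have "\<gamma> = of_rat (inverse (of_int p)) * zcomb \<alpha> (r ^ 2 - a) r 1"
    by (simp add: \<gamma>_def divide_inverse of_rat_inverse mult.commute)
  then have "\<gamma> \<in> rat_adjoin \<alpha>"
    unfolding rat_adjoin_eq zcomb_eq_qcomb qcomb_scale by blast
  moreover have "algebraic_int \<gamma>"
    unfolding \<gamma>_def by (rule algebraic_int_cofactor_divide[OF p0 r])
  ultimately have "\<gamma> \<in> int_adjoin \<alpha>"
    unfolding eq[symmetric] ring_of_integers_def by blast
  moreover have "zcomb \<alpha> (r ^ 2 - a) r 1 = of_int p * \<gamma>" using p0 by (simp add: \<gamma>_def)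
  ultimately have "p dvd 1" using dvd_if_zcomb_eq by blast
  then show False using p by auto
next
  assume none: "\<forall>p::int. prime p \<longrightarrow> \<not> (\<exists>r. p dvd 3 * r ^ 2 - a \<and> p ^ 2 dvd r ^ 3 - a * r + b)"
  \<comment> \<open>The denominator is removed one prime factor at a time: if \<open>p * n\<close>
    clears \<open>x\<close>, the absence of a double root at \<open>p\<close> shows that
    \<open>n\<close> already does.\<close>
  have descend: "x \<in> int_adjoin \<alpha>" if "n > 0" "algebraic_int x" "of_nat n * x \<in> int_adjoin \<alpha>" for n x
    using that
  proof (induction n arbitrary: x rule: prime_divisors_induct)
    case (factor p n)
    have "algebraic_int (of_nat n * x)" by (intro algebraic_int_mult factor.prems) simp
    moreover have "of_int (int p) * (of_nat n * x) \<in> int_adjoin \<alpha>" 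
      using factor.prems by (simp add: mult.assoc)
    moreover have "prime (int p)" using factor.hyps by simp
    ultimately have "of_nat n * x \<in> int_adjoin \<alpha>"
      using double_root_if_not_maximal none by blast
    then show ?case using factor by simp
  qed simp_all
  show "ring_of_integers (rat_adjoin \<alpha>) = int_adjoin \<alpha>"
  proof
    show "ring_of_integers (rat_adjoin \<alpha>) \<subseteq> int_adjoin \<alpha>"
      unfolding ring_of_integers_def using descend rat_adjoin_denominator by blast
    have "int_adjoin \<alpha> \<subseteq> rat_adjoin \<alpha>"
      unfolding int_adjoin_eq rat_adjoin_eq zcomb_eq_qcomb by blast
    then show "int_adjoin \<alpha> \<subseteq> ring_of_integers (rat_adjoin \<alpha>)"
      unfolding ring_of_integers_def using algebraic_int_int_adjoin by blast
  qed
qed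

end

subsection \<open>Double roots modulo a prime\<close>

lemma le_padic_val_iff:
  assumes "prime p"
  shows "enat k \<le> padic_val p n \<longleftrightarrow> int p ^ k dvd n"
proof (cases "n = 0")
  case False
  have "\<not> is_unit (int p)" using assms by (simp add: prime_gt_Suc_0_nat nat_neq_iff)
  then show ?thesis
    using False power_dvd_iff_le_multiplicity[of n "int p" k] by (simp add: padic_val_def)
qed (simp add: padic_val_def)

lemma padic_val_iffs:
  assumes "prime p"
  shows "padic_val p n \<ge> 1 \<longleftrightarrow> int p dvd n"
    and "padic_val p n = 0 \<longleftrightarrow> \<not> int p dvd n"
    and "padic_val p n \<le> 1 \<longleftrightarrow> \<not> int p ^ 2 dvd n"
    and "padic_val p n = 1 \<longleftrightarrow> int p dvd n \<and> \<not> int p ^ 2 dvd n"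
proof -
  show ge: "padic_val p n \<ge> 1 \<longleftrightarrow> int p dvd n"
    using le_padic_val_iff[OF assms, of 1 n] by (simp add: one_enat_def)
  then show "padic_val p n = 0 \<longleftrightarrow> \<not> int p dvd n"
    by (cases "padic_val p n") (auto simp: one_enat_def zero_enat_def)
  show le: "padic_val p n \<le> 1 \<longleftrightarrow> \<not> int p ^ 2 dvd n"
    using le_padic_val_iff[OF assms, of 2 n]
    by (cases "padic_val p n") (auto simp: one_enat_def)
  show "padic_val p n = 1 \<longleftrightarrow> int p dvd n \<and> \<not> int p ^ 2 dvd n"
    using ge le by auto
qed

lemma exactly_one_Nil: "exactly_one [] \<longleftrightarrow> False"
  by (simp add: exactly_one_def Ex1_def)

lemma exactly_one_Cons:
  "exactly_one (P # Ps) \<longleftrightarrow> (if P then \<not> (\<exists>Q\<in>set Ps. Q) else exactly_one Ps)"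
proof (cases P)
  case True
  have "(\<exists>!i. i < Suc (length Ps) \<and> (P # Ps) ! i) \<longleftrightarrow> (\<forall>i < length Ps. \<not> Ps ! i)"
    using True by (auto simp: Ex1_def nth_Cons' gr0_conv_Suc)
  then show ?thesis using True by (auto simp: exactly_one_def in_set_conv_nth)
next
  case False
  have "(i < Suc n \<and> (P # Ps) ! i) \<longleftrightarrow> (\<exists>j. i = Suc j \<and> j < n \<and> Ps ! j)" for i n
    using False by (cases i) auto
  moreover have "(\<exists>!i. \<exists>j. i = Suc j \<and> Q j) \<longleftrightarrow> (\<exists>!j. Q j)" for Q
    by (metis nat.inject)
  ultimately show ?thesis using False by (simp add: exactly_one_def)
qed

lemmas exactly_one_simps = exactly_one_Nil exactly_one_Cons

section \<open>The double-root condition at 2 and at 3\<close>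

definition local_double_root :: "int \<Rightarrow> int \<Rightarrow> int \<Rightarrow> bool" where
  "local_double_root a b p \<longleftrightarrow> (\<exists>r. p dvd 3 * r ^ 2 - a \<and> p ^ 2 dvd r ^ 3 - a * r + b)"

text \<open>Shifting \<open>r\<close> by \<open>2 k\<close> changes \<open>f(r)\<close> modulo 4 by
  \<open>2 k f'(r)\<close>, which vanishes when \<open>f'(r)\<close> is even. So only
  \<open>r = 0\<close> and \<open>r = 1\<close> matter, and the parity of \<open>a\<close> decides
  between them.\<close>

lemma local_double_root_2_iff:
  "local_double_root a b 2 \<longleftrightarrow> (even a \<and> 4 dvd b) \<or> (odd a \<and> 4 dvd b - a + 1)"
proof
  assume "local_double_root a b 2"
  then obtain r where r: "2 dvd 3 * r ^ 2 - a" "4 dvd r ^ 3 - a * r + b"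
    by (auto simp: local_double_root_def)
  show "(even a \<and> 4 dvd b) \<or> (odd a \<and> 4 dvd b - a + 1)"
  proof (cases "even r")
    case True
    then have "even a" using r(1) by simp
    with True obtain k m where "r = 2 * k" "a = 2 * m" by (auto elim!: evenE)
    then have "r ^ 3 - a * r = 4 * (2 * k ^ 3 - m * k)"
      by (simp add: power3_eq_cube algebra_simps)
    then have "b = (r ^ 3 - a * r + b) - 4 * (2 * k ^ 3 - m * k)" by simp
    then have "4 dvd b" using r(2) by (metis dvd_diff dvd_triv_left)
    with \<open>even a\<close> show ?thesis by blast
  next
    case False
    then have "odd a" using r(1) by simp
    with False obtain k m where km: "r = 2 * k + 1" "a = 2 * m + 1" by (auto elim!: oddE)
    then have "b - a + 1 = (r ^ 3 - a * r + b) - 4 * (2 * k ^ 3 + 3 * k ^ 2 + k - m * k)"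
      by (simp add: power3_eq_cube power2_eq_square algebra_simps)
    then have "4 dvd b - a + 1" using r(2) by (metis dvd_diff dvd_triv_left)
    with \<open>odd a\<close> show ?thesis by blast
  qed
next
  assume "(even a \<and> 4 dvd b) \<or> (odd a \<and> 4 dvd b - a + 1)"
  then show "local_double_root a b 2"
  proof
    assume "even a \<and> 4 dvd b"
    then show ?thesis unfolding local_double_root_def by (intro exI[of _ 0]) simp
  next
    assume "odd a \<and> 4 dvd b - a + 1"
    then show ?thesis unfolding local_double_root_def by (intro exI[of _ 1]) (simp add: algebra_simps)
  qed
qed

lemma not_local_double_root_2_iff:
  "\<not> local_double_root a b 2 \<longleftrightarrow>
    exactly_one
      [[b = 1] (mod 2),
       [a = 0] (mod 2) \<and> [b = 2] (mod 4),
       [a = 3] (mod 4) \<and> [b = 0] (mod 4),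
       [a = 1] (mod 4) \<and> [b = 2] (mod 4)]"
  unfolding local_double_root_2_iff exactly_one_simps cong_def by simp presburger

text \<open>Modulo 3 the derivative is \<open>- a\<close>; once \<open>3 dvd a\<close>, Fermat's
  little theorem reduces \<open>f(r)\<close> to \<open>r + b\<close>. So \<open>- b\<close> is the
  only candidate modulo 3, and \<open>f(- b) = - b (b^2 - (a + 1))\<close>.\<close>

lemma local_double_root_3_iff:
  "local_double_root a b 3 \<longleftrightarrow> 3 dvd a \<and> (9 dvd b \<or> (\<not> 3 dvd b \<and> 9 dvd b ^ 2 - (a + 1)))"
proof -
  have "local_double_root a b 3 \<longleftrightarrow> 3 dvd a \<and> 9 dvd b * (b ^ 2 - (a + 1))"
  proof
    assume "local_double_root a b 3"
    then obtain r where r: "3 dvd 3 * r ^ 2 - a" "9 dvd r ^ 3 - a * r + b"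
      by (auto simp: local_double_root_def)
    have "3 dvd 3 * r ^ 2 - (3 * r ^ 2 - a)" using r(1) by (rule dvd_diff[rotated]) simp
    then have a: "3 dvd a" by simp
    then obtain m where m: "a = 3 * m" by (auto elim: dvdE)
    have fermat: "3 dvd r ^ 3 - r"
    proof -
      have "r mod 3 = 0 \<or> r mod 3 = 1 \<or> r mod 3 = 2" by presburger
      then have "r ^ 3 mod 3 = r mod 3"
        using power_mod[of r 3 3, symmetric] by auto
      then show ?thesis by (simp add: mod_eq_dvd_iff)
    qed
    have r3: "3 dvd r ^ 3 - a * r + b" using r(2) by (rule dvd_trans[rotated]) simp
    have "3 dvd (r ^ 3 - a * r + b) - (r ^ 3 - r) + a * r"
      by (rule dvd_add[OF dvd_diff[OF r3 fermat] dvd_mult2[OF a]])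
    then have "3 dvd r + b" by (simp add: algebra_simps)
    then obtain k where "r + b = 3 * k" by (auto elim: dvdE)
    then have k: "r = 3 * k - b" by simp
    have "b * (b ^ 2 - (a + 1)) =
        9 * (3 * k ^ 3 - 3 * k ^ 2 * b + k * b ^ 2 - m * k) - (r ^ 3 - a * r + b)"
      unfolding k m by (simp add: power3_eq_cube power2_eq_square algebra_simps)
    then have "9 dvd b * (b ^ 2 - (a + 1))" using r(2) by simp
    with a show "3 dvd a \<and> 9 dvd b * (b ^ 2 - (a + 1))" by blast
  next
    assume *: "3 dvd a \<and> 9 dvd b * (b ^ 2 - (a + 1))"
    have "(- b) ^ 3 - a * (- b) + b = - (b * (b ^ 2 - (a + 1)))"
      by (simp add: power3_eq_cube power2_eq_square algebra_simps)
    then show "local_double_root a b 3"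
      using * unfolding local_double_root_def by (intro exI[of _ "- b"]) (auto simp: dvd_minus_iff)
  qed
  \<comment> \<open>If 3 divides \<open>b\<close>, the other factor is \<open>- 1\<close> modulo 3;
    otherwise \<open>b\<close> is a unit. So a single factor carries the whole 9.\<close>
  moreover have "9 dvd b * (b ^ 2 - (a + 1)) \<longleftrightarrow> 9 dvd b \<or> (\<not> 3 dvd b \<and> 9 dvd b ^ 2 - (a + 1))"
    if a: "3 dvd a"
  proof (cases "3 dvd b")
    case True
    have "\<not> 3 dvd b ^ 2 - (a + 1)"
    proof
      assume "3 dvd b ^ 2 - (a + 1)"
      moreover have "3 dvd b ^ 2 - a" using True a by (simp add: power2_eq_square)
      ultimately have "3 dvd (b ^ 2 - a) - (b ^ 2 - (a + 1))" by (rule dvd_diff[rotated])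
      then show False by simp
    qed
    then have "coprime 3 (b ^ 2 - (a + 1))" by (intro prime_imp_coprime) simp_all
    then have "coprime (3 ^ 2) (b ^ 2 - (a + 1))" by (simp only: coprime_power_left_iff) simp
    then have "coprime 9 (b ^ 2 - (a + 1))" by simp
    then show ?thesis using True by (simp add: coprime_dvd_mult_left_iff)
  next
    case False
    then have "coprime 3 b" by (intro prime_imp_coprime) simp_all
    then have "coprime (3 ^ 2) b" by (simp only: coprime_power_left_iff) simp
    then have "coprime 9 b" by simp
    moreover have "\<not> 9 dvd b" using False dvd_trans[of 3 9 b] by auto
    ultimately show ?thesis using False by (simp add: coprime_dvd_mult_right_iff)
  qed
  ultimately show ?thesis by blast
qed

text \<open>For \<open>a\<close> congruent to 3 modulo 9 the residue of \<open>a + 1\<close> is 4,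
  so the last two alternatives are one condition split by the residue of \<open>a\<close>.\<close>

lemma not_local_double_root_3_iff:
  "\<not> local_double_root a b 3 \<longleftrightarrow>
    exactly_one
      [padic_val 3 a = 0,
       padic_val 3 a \<ge> 1 \<and> padic_val 3 b = 1,
       padic_val 3 a \<ge> 1 \<and> \<not> [a = 3] (mod 9) \<and> padic_val 3 b = 0 \<and> \<not> [b ^ 2 = a + 1] (mod 9),
       [a = 3] (mod 9) \<and> padic_val 3 b = 0 \<and> \<not> [b ^ 2 = 4] (mod 9)]"
proof -
  have a3: "3 dvd a" if "[a = 3] (mod 9)"
  proof -
    have "3 dvd a - 3" using that dvd_trans[of 3 9 "a - 3"] by (simp add: cong_iff_dvd_diff)
    then have "3 dvd (a - 3) + 3" by (rule dvd_add) simp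
    then show ?thesis by simp
  qed
  have "[b ^ 2 = a + 1] (mod 9) \<longleftrightarrow> [b ^ 2 = 4] (mod 9)" if "[a = 3] (mod 9)"
    using cong_add[OF that cong_refl[of 1]] by (auto intro: cong_trans cong_sym)
  moreover have "9 dvd b ^ 2 - (a + 1) \<longleftrightarrow> [b ^ 2 = a + 1] (mod 9)"
    by (simp add: cong_iff_dvd_diff)
  moreover have "9 dvd b \<Longrightarrow> 3 dvd b" using dvd_trans[of 3 9 b] by simp
  moreover have "prime (3 :: nat)" by simp
  note padic_val_iffs[OF this]
  ultimately show ?thesis
    unfolding local_double_root_3_iff exactly_one_simps using a3 by simp blast
qed

section \<open>The discriminant and the primes above 3\<close>

lemma local_double_root_discriminant:
  assumes "local_double_root a b p"
  shows "p ^ 2 dvd 4 * a ^ 3 - 27 * b ^ 2"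
proof -
  obtain r where r: "p dvd 3 * r ^ 2 - a" "p ^ 2 dvd r ^ 3 - a * r + b"
    using assms by (auto simp: local_double_root_def)
  then obtain d c where "3 * r ^ 2 - a = p * d" "r ^ 3 - a * r + b = p ^ 2 * c"
    by (auto elim!: dvdE)
  then have a: "a = 3 * r ^ 2 - p * d" and b: "b = p ^ 2 * c - r ^ 3 + a * r"
    by (simp_all add: algebra_simps)
  \<comment> \<open>With \<open>f'(r) = p d\<close> and \<open>f(r) = p^2 c\<close> substituted, the
    terms free of \<open>p\<close> and those linear in \<open>p\<close> cancel.\<close>
  have "4 * a ^ 3 - 27 * b ^ 2 =
      p ^ 2 * (9 * r ^ 2 * d ^ 2 - 4 * p * d ^ 3 - 27 * p ^ 2 * c ^ 2 - 108 * c * r ^ 3 + 54 * p * c * d * r)"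
    unfolding b a by (simp add: power3_eq_cube power2_eq_square algebra_simps)
  then show ?thesis by simp
qed

lemma local_double_root_if_discriminant:
  assumes p: "prime p" and "\<not> p dvd 2 * a" and \<Delta>: "p ^ 2 dvd 4 * a ^ 3 - 27 * b ^ 2"
  shows "local_double_root a b p"
proof -
  have "coprime p (2 * a)" using assms by (intro prime_imp_coprime)
  then have cop: "coprime (p ^ k) ((2 * a) ^ l)" for k l by simp
  obtain x where x: "[(2 * a) * x = 1] (mod p ^ 2)"
    using cong_solve_coprime_int cop[of 2 1] by (metis coprime_commute power_one_right)
  \<comment> \<open>This is \<open>3 b / (2 a)\<close> modulo \<open>p ^ 2\<close>, the only
    possible common root of \<open>f\<close> and \<open>f'\<close>, since
    \<open>3 f(r) - r f'(r) = 3 b - 2 a r\<close>.\<close>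
  define r where "r = x * (3 * b)"
  have "[(2 * a) * x * (3 * b) = 1 * (3 * b)] (mod p ^ 2)" by (rule cong_scalar_right[OF x])
  then have r: "p ^ 2 dvd 2 * a * r - 3 * b" by (simp add: cong_iff_dvd_diff r_def mult_ac)
  \<comment> \<open>Modulo \<open>2 a r - 3 b\<close>, clearing denominators turns
    \<open>f'(r)\<close> into the negated discriminant, and below \<open>f(r)\<close> into that
    times \<open>b\<close>.\<close>
  have "(2 * a) ^ 2 * (3 * r ^ 2 - a) =
      (2 * a * r - 3 * b) * (3 * (2 * a * r + 3 * b)) - (4 * a ^ 3 - 27 * b ^ 2)"
    by (simp add: power3_eq_cube power2_eq_square algebra_simps)
  then have "p ^ 2 dvd (2 * a) ^ 2 * (3 * r ^ 2 - a)"
    using r \<Delta> by (metis dvd_diff dvd_mult2)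
  then have "p ^ 2 dvd 3 * r ^ 2 - a"
    using cop by (simp only: coprime_dvd_mult_right_iff)
  then have "p dvd 3 * r ^ 2 - a" by (rule dvd_trans[rotated]) simp
  moreover have "(2 * a) ^ 3 * (r ^ 3 - a * r + b) =
      (2 * a * r - 3 * b) * ((2 * a * r) ^ 2 + 3 * b * (2 * a * r) + 9 * b ^ 2 - 4 * a ^ 3)
      - (4 * a ^ 3 - 27 * b ^ 2) * b"
    by (simp add: power3_eq_cube power2_eq_square algebra_simps)
  then have "p ^ 2 dvd (2 * a) ^ 3 * (r ^ 3 - a * r + b)"
    using r \<Delta> by (metis dvd_diff dvd_mult2)
  then have "p ^ 2 dvd r ^ 3 - a * r + b"
    using cop by (simp only: coprime_dvd_mult_right_iff)
  ultimately show ?thesis unfolding local_double_root_def by blast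
qed

text \<open>Here \<open>f'(r)\<close> is \<open>3 r^2\<close> modulo \<open>p\<close>, which forces
  \<open>p dvd r\<close>; then \<open>r^3\<close> and \<open>a r\<close> vanish modulo
  \<open>p^2\<close>, and \<open>f(r)\<close> is \<open>b\<close> there.\<close>

lemma local_double_root_if_dvd:
  assumes p: "prime p" and "\<not> p dvd 3" and a: "p dvd a"
  shows "local_double_root a b p \<longleftrightarrow> p ^ 2 dvd b"
proof
  assume "local_double_root a b p"
  then obtain r where r: "p dvd 3 * r ^ 2 - a" "p ^ 2 dvd r ^ 3 - a * r + b"
    by (auto simp: local_double_root_def)
  have "p dvd (3 * r ^ 2 - a) + a" using r(1) a by (rule dvd_add)
  then have "p dvd r" using p assms(2) by (auto simp: prime_dvd_mult_iff prime_dvd_power_iff)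
  then obtain k m where "r = p * k" "a = p * m" using a by (auto elim!: dvdE)
  then have "b = (r ^ 3 - a * r + b) - p ^ 2 * (p * k ^ 3 - m * k)"
    by (simp add: power3_eq_cube power2_eq_square algebra_simps)
  then show "p ^ 2 dvd b" using r(2) by (metis dvd_diff dvd_triv_left)
next
  assume "p ^ 2 dvd b"
  then show "local_double_root a b p"
    unfolding local_double_root_def using a by (intro exI[of _ 0]) simp
qed

text \<open>Modulo \<open>p\<close> the polynomial is \<open>x (x^2 - a)\<close> with
  \<open>a\<close> a unit and \<open>p\<close> odd, so it has no repeated root.\<close>

lemma not_local_double_root_if_coprime:
  assumes p: "prime p" and "\<not> p dvd 2" and a: "\<not> p dvd a" and b: "p dvd b"
  shows "\<not> local_double_root a b p"
proof
  assume "local_double_root a b p"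
  then obtain r where r: "p dvd 3 * r ^ 2 - a" "p ^ 2 dvd r ^ 3 - a * r + b"
    by (auto simp: local_double_root_def)
  have "p dvd r ^ 3 - a * r + b" using r(2) by (rule dvd_trans[rotated]) simp
  then have "p dvd (r ^ 3 - a * r + b) - b" using b by (rule dvd_diff)
  moreover have "(r ^ 3 - a * r + b) - b = r * (r ^ 2 - a)"
    by (simp add: power3_eq_cube power2_eq_square algebra_simps)
  ultimately have "p dvd r \<or> p dvd r ^ 2 - a" using p by (simp add: prime_dvd_mult_iff)
  then have "p dvd r"
  proof
    assume "p dvd r ^ 2 - a"
    then have "p dvd (3 * r ^ 2 - a) - (r ^ 2 - a)" by (rule dvd_diff[OF r(1)])
    then show ?thesis using p assms(2) by (auto simp: prime_dvd_mult_iff prime_dvd_power_iff)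
  qed
  then have "p dvd 3 * r ^ 2" by (simp add: power2_eq_square)
  then have "p dvd 3 * r ^ 2 - (3 * r ^ 2 - a)" using r(1) by (rule dvd_diff)
  then show False using a by simp
qed

lemma not_local_double_root_iff:
  assumes p: "prime p" "p > 3"
  shows "\<not> local_double_root a b (int p) \<longleftrightarrow>
    exactly_one
      [padic_val p a = 0 \<and> padic_val p b \<ge> 1,
       padic_val p a \<ge> 1 \<and> padic_val p b \<le> 1,
       padic_val p a = 0 \<and> padic_val p b = 0 \<and> padic_val p (4 * a ^ 3 - 27 * b ^ 2) \<le> 1]"
proof -
  have p': "prime (int p)" using p by simp
  have small: "\<not> int p dvd 2" "\<not> int p dvd 3" using p by (auto dest: zdvd_imp_le)
  have "\<not> int p dvd a \<Longrightarrow> int p dvd b \<Longrightarrow> \<not> local_double_root a b (int p)"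
    using not_local_double_root_if_coprime[OF p' small(1)] by blast
  moreover have "int p dvd a \<Longrightarrow> local_double_root a b (int p) \<longleftrightarrow> int p ^ 2 dvd b"
    using local_double_root_if_dvd[OF p' small(2)] by blast
  moreover have "\<not> int p dvd a \<Longrightarrow> local_double_root a b (int p) \<longleftrightarrow> int p ^ 2 dvd 4 * a ^ 3 - 27 * b ^ 2"
    using local_double_root_if_discriminant[OF p'] local_double_root_discriminant small(1) p'
    by (metis prime_dvd_mult_iff)
  ultimately show ?thesis
    unfolding exactly_one_simps padic_val_iffs[OF p(1)] by simp blast
qed

theorem corollary7p6:
  fixes \<alpha> :: "'a :: field_char_0" and L :: "'a set" and a b \<Delta> :: int
  assumes "L = rat_adjoin \<alpha>"
    and "is_cubic_number_field L"
    and "\<alpha> ^ 3 - of_int a * \<alpha> + of_int b = 0"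
    and "\<forall>p. prime p \<longrightarrow> padic_val p a < 2 \<or> padic_val p b < 3"
    and "\<Delta> = 4 * a ^ 3 - 27 * b ^ 2"
  shows "(is_integral_basis L {1, \<alpha>, \<alpha> ^ 2} \<longleftrightarrow> ring_of_integers L = int_adjoin \<alpha>) \<and>
    (is_integral_basis L {1, \<alpha>, \<alpha> ^ 2} \<longleftrightarrow>
      exactly_one
        [[b = 1] (mod 2),
         [a = 0] (mod 2) \<and> [b = 2] (mod 4),
         [a = 3] (mod 4) \<and> [b = 0] (mod 4),
         [a = 1] (mod 4) \<and> [b = 2] (mod 4)] \<and>
      exactly_one
        [padic_val 3 a = 0,
         padic_val 3 a \<ge> 1 \<and> padic_val 3 b = 1,
         padic_val 3 a \<ge> 1 \<and> \<not> [a = 3] (mod 9) \<and> padic_val 3 b = 0 \<and> \<not> [b ^ 2 = a + 1] (mod 9),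
         [a = 3] (mod 9) \<and> padic_val 3 b = 0 \<and> \<not> [b ^ 2 = 4] (mod 9)] \<and>
      (\<forall>p. prime p \<and> p > 3 \<longrightarrow>
        exactly_one
          [padic_val p a = 0 \<and> padic_val p b \<ge> 1,
           padic_val p a \<ge> 1 \<and> padic_val p b \<le> 1,
           padic_val p a = 0 \<and> padic_val p b = 0 \<and> padic_val p \<Delta> \<le> 1]))"
proof -
  interpret cubic_root \<alpha> a b by unfold_locales (fact assms(3))
  interpret cubic_generator \<alpha> a b
    using cubic_generator_if_cubic_field assms(1,2) by blast
  have basis: "is_integral_basis L {1, \<alpha>, \<alpha> ^ 2} \<longleftrightarrow> ring_of_integers L = int_adjoin \<alpha>"
    by (rule is_integral_basis_powers_iff)
  have "ring_of_integers L = int_adjoin \<alpha> \<longleftrightarrow> (\<forall>p::int. prime p \<longrightarrow> \<not> local_double_root a b p)"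
    unfolding assms(1) ring_of_integers_eq_iff local_double_root_def ..
  also have "\<dots> \<longleftrightarrow> (\<forall>p::nat. prime p \<longrightarrow> \<not> local_double_root a b (int p))"
    by (metis prime_int_nat_transfer prime_nat_int_transfer int_nat_eq prime_ge_0_int)
  also have "\<dots> \<longleftrightarrow> \<not> local_double_root a b 2 \<and> \<not> local_double_root a b 3 \<and>
      (\<forall>p::nat. prime p \<and> p > 3 \<longrightarrow> \<not> local_double_root a b (int p))"
  proof -
    have "p = 2 \<or> p = 3 \<or> p > 3" if "prime p" for p :: nat
      using prime_ge_2_nat[OF that] by linarith
    moreover have "prime (2::nat)" "prime (3::nat)" by simp_all
    moreover have "int 2 = 2" "int 3 = 3" by simp_all
    ultimately show ?thesis by metis
  qed
  finally show ?thesis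
    unfolding basis not_local_double_root_2_iff not_local_double_root_3_iff assms(5)
    using not_local_double_root_iff[of _ a b] by auto
qed

end
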